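(* Let $\Phi:M_N(\mathbb{C})\to M_N(\mathbb{C})$ be a quantum operation with Kraus operators $\{E_i\}$ and Choi rank $D$. Let $\mathcal{C}$ be a quantum error correcting code for $\Phi$ with projection $P_{\mathcal C}$ and matrix $\Lambda=(\lambda_{ij})$ defined by $P_{\mathcal C}E_i^\dagger E_jP_{\mathcal C}=\lambda_{ij}P_{\mathcal C}$ for all $i,j$. Then the entropy $S(\Phi,\mathcal{C})=S(\Lambda)$ lies in the closed interval $[0,\log D]$. Moreover: (i) $S(\Phi,\mathcal{C})=0$ if and only if $\mathcal{C}$ is a unitarily correctable code for $\Phi$; (ii) $S(\Phi,\mathcal{C})=\log D$ if and only if $\mathcal{C}$ is a non-degenerate code for $\Phi$.
   Context: A quantum operation is a completely positive trace-preserving map $\Phi(\rho)=\sum_i E_i\rho E_i^\dagger$, $\sum_iE_i^\dagger E_i=\mathbb{1}$. The Choi rank of $\Phi$ is the rank of its Choi (dynamical) matrix, equivalently the minimal number of Kraus operators representing $\Phi$. A subspace $\mathcal C$ with orthogonal projection $P_{\mathcal C}$ is a (quantum error correcting) code for $\Phi$ if there are scalars $\lambda_{ij}$ with $P_{\mathcal C}E_i^\dagger E_jP_{\mathcal C}=\lambda_{ij}P_{\mathcal C}$ for all $i,j$; equivalently there is a quantum operation $\Psi$ with $\Psi\circ\Phi\circ\mathcal P_{\mathcal C}=\mathcal P_{\mathcal C}$, where $\mathcal P_{\mathcal C}(\rho)=P_{\mathcal C}\rho P_{\mathcal C}$. The matrix $\Lambda=(\lambda_{ij})$ is then a density matrix;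 changing the Kraus family changes $\Lambda$ by unitary conjugation (after padding with zeros), so its spectrum does not depend on the choice. The entropy of the code is $S(\Phi,\mathcal C):=S(\Lambda)=-\mathrm{Tr}\,\Lambda\log\Lambda$, with $\log$ the base-2 logarithm. $\mathcal{C}$ is unitarily correctable if there is a unitary $U$ such that $\Psi(\rho)=U\rho U^\dagger$ satisfies $\Psi\circ\Phi\circ\mathcal P_{\mathcal C}=\mathcal P_{\mathcal C}$. $\mathcal C$ is non-degenerate for $\Phi$ if $\operatorname{rank}\Lambda$ equals the Choi rank $D$ of $\Phi$ and all nonzero eigenvalues of $\Lambda$ are equal. *)

theory Defs
  imports "Jordan_Normal_Form.Schur_Decomposition" "Jordan_Normal_Form.DL_Rank"
    "HOL-Computational_Algebra.Fundamental_Theorem_Algebra"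
begin

definition kraus_family :: "nat \<Rightarrow> nat \<Rightarrow> (nat \<Rightarrow> complex mat) \<Rightarrow> bool" where
  "kraus_family N m Es \<longleftrightarrow>
     (\<forall>i<m. Es i \<in> carrier_mat N N) \<and>
     mat N N (\<lambda>(r,s). \<Sum>i<m. (mat_adjoint (Es i) * Es i) $$ (r,s)) = 1\<^sub>m N"

definition kraus_map :: "nat \<Rightarrow> nat \<Rightarrow> (nat \<Rightarrow> complex mat) \<Rightarrow> complex mat \<Rightarrow> complex mat" where
  "kraus_map N m Es \<rho> =
     mat N N (\<lambda>(r,s). \<Sum>i<m. (Es i * \<rho> * mat_adjoint (Es i)) $$ (r,s))"

definition matrix_unit :: "nat \<Rightarrow> nat \<Rightarrow> nat \<Rightarrow> complex mat" where
  "matrix_unit N a b = mat N N (\<lambda>(r,s). if r = a \<and> s = b then 1 else 0)"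

text \<open>Choi matrix C = sum_{a,b} |a><b| (x) Phi(|a><b|), an N^2 x N^2 matrix; the row index
  a*N + c corresponds to the basis vector |a> (x) |c>.\<close>
definition choi_matrix :: "nat \<Rightarrow> (complex mat \<Rightarrow> complex mat) \<Rightarrow> complex mat" where
  "choi_matrix N \<Phi> = mat (N*N) (N*N)
     (\<lambda>(r,s). \<Phi> (matrix_unit N (r div N) (s div N)) $$ (r mod N, s mod N))"

definition choi_rank :: "nat \<Rightarrow> (complex mat \<Rightarrow> complex mat) \<Rightarrow> nat" where
  "choi_rank N \<Phi> = vec_space.rank (N*N) (choi_matrix N \<Phi>)"

definition orth_projection :: "nat \<Rightarrow> complex mat \<Rightarrow> bool" where
  "orth_projection N P \<longleftrightarrow> P \<in> carrier_mat N N \<and> P * P = P \<and> mat_adjoint P = P"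

definition unitary_mat :: "nat \<Rightarrow> complex mat \<Rightarrow> bool" where
  "unitary_mat N U \<longleftrightarrow> U \<in> carrier_mat N N \<and> U * mat_adjoint U = 1\<^sub>m N \<and> mat_adjoint U * U = 1\<^sub>m N"

definition unitarily_correctable :: "nat \<Rightarrow> (complex mat \<Rightarrow> complex mat) \<Rightarrow> complex mat \<Rightarrow> bool" where
  "unitarily_correctable N \<Phi> P \<longleftrightarrow>
     (\<exists>U. unitary_mat N U \<and>
        (\<forall>\<rho> \<in> carrier_mat N N. U * \<Phi> (P * \<rho> * P) * mat_adjoint U = P * \<rho> * P))"

definition eigenvalues_mset :: "complex mat \<Rightarrow> complex multiset" where
  "eigenvalues_mset A = proots (char_poly A)"

text \<open>Von Neumann entropy -Tr(A log2 A) = - sum_k t_k log2 t_k over the eigenvalues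
  (with the convention 0 log 0 = 0).\<close>
definition entropy :: "complex mat \<Rightarrow> real" where
  "entropy A = (\<Sum>x\<in>#eigenvalues_mset A. (if Re x \<le> 0 then 0 else - Re x * log 2 (Re x)))"

definition nondegenerate_code :: "nat \<Rightarrow> complex mat \<Rightarrow> nat \<Rightarrow> bool" where
  "nondegenerate_code m \<Lambda> D \<longleftrightarrow>
     vec_space.rank m \<Lambda> = D \<and>
     (\<forall>a b. eigenvalue \<Lambda> a \<and> eigenvalue \<Lambda> b \<and> a \<noteq> 0 \<and> b \<noteq> 0 \<longrightarrow> a = b)"

end

(* Write F_i = E_i P, so that the code condition reads F_i^* F_j = lam_ij P. Comparing one nonzero
   diagonal entry of P shows that Lambda is a Gram matrix L^* L / q with L = R K, where K is the matrix
   whose columns are the vectorised Kraus operators. Hence Lambda is positive semidefinite of trace 1,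
   and since the Choi matrix is K K^*, the matrix Lambda^2 factors through it and
   rank Lambda = rank (Lambda^2) <= D. The entropy bounds are then those of a probability vector with
   at most D nonzero entries.
   Entropy 0 means lam_ij = conj(u_i) u_j for a unit vector u; then F_j = u_j W for one partial isometry
   W with W^* W = P, and the adjoint of any unitary extension of W corrects the code. Conversely, if
   U corrects the code and G_i = U F_i, the case rho = 1 gives sum_i G_i G_i^* = P, hence
   G_k^* P G_l = (Lambda^2)_kl P, and inserting the sum once more shows that Lambda^2 is idempotent.
   As Lambda is positive semidefinite, its eigenvalues are then 0 or 1. *)
theory Submission
  imports Defs
begin

section \<open>Adjoints, sums and traces\<close>

text \<open>The number m of Kraus operators is arbitrary and may exceed D, so the bound log D cannot
  come from the size of Lambda. A factorisation Lambda = X K bounds its rank only by that of K.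
  Since Lambda is Hermitian, it also equals K^* X^*, and in the product X K K^* X^* of the two forms
  the Choi matrix appears in the middle. Squaring is harmless: it keeps the nonzero eigenvalues
  nonzero. The square in the converse of (i) has another origin. The sum for P can be inserted only
  where a P stands; G_k^* G_l offers no such place, whereas G_k^* P G_l does. A unitary extension of
  W exists because W^* W and W W^* are projections of equal trace, hence unitarily equivalent. The
  equivalence is kept on the kernel of P and replaced by W on its range.\<close>

lemma mat_adjoint_dims [simp]:
  "dim_row (mat_adjoint A) = dim_col A" "dim_col (mat_adjoint A) = dim_row A"
  by (simp_all add: mat_adjoint_def)

lemma mat_adjoint_carrier [simp]: "A \<in> carrier_mat n k \<Longrightarrow> mat_adjoint A \<in> carrier_mat k n"
  by (rule carrier_matI) auto

lemma mat_adjoint_index [simp]: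
  "i < dim_col A \<Longrightarrow> j < dim_row A \<Longrightarrow> mat_adjoint A $$ (i,j) = conjugate (A $$ (j,i))"
  by (simp add: mat_adjoint_def mat_of_rows_index)

lemma mat_adjoint_adjoint [simp]: "mat_adjoint (mat_adjoint A) = A"
  by (rule eq_matI) auto

lemma mat_adjoint_one [simp]: "mat_adjoint (1\<^sub>m n :: complex mat) = 1\<^sub>m n"
  by (rule eq_matI) auto

lemma mat_adjoint_mult:
  assumes "A \<in> carrier_mat n k" "B \<in> carrier_mat k l"
  shows "mat_adjoint (A * B :: complex mat) = mat_adjoint B * mat_adjoint A"
  using assms by (intro eq_matI) (auto simp: scalar_prod_def mult.commute intro!: sum.cong)

lemma mat_adjoint_minus:
  assumes "A \<in> carrier_mat n k" "B \<in> carrier_mat n k"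
  shows "mat_adjoint (A - B :: complex mat) = mat_adjoint A - mat_adjoint B"
  using assms by (intro eq_matI) auto

lemma mat_adjoint_add:
  assumes "A \<in> carrier_mat n k" "B \<in> carrier_mat n k"
  shows "mat_adjoint (A + B :: complex mat) = mat_adjoint A + mat_adjoint B"
  using assms by (intro eq_matI) auto

lemma mat_adjoint_smult: "mat_adjoint (c \<cdot>\<^sub>m A :: complex mat) = cnj c \<cdot>\<^sub>m mat_adjoint A"
  by (rule eq_matI) auto

lemma smult_smult_mat: "a \<cdot>\<^sub>m (b \<cdot>\<^sub>m A) = (a * b :: 'a :: semigroup_mult) \<cdot>\<^sub>m A"
  by (rule eq_matI) (auto simp: mult.assoc)

lemma minus_mat_eq_0D:
  assumes "A \<in> carrier_mat n k" "B \<in> carrier_mat n k" "A - B = 0\<^sub>m n k"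
  shows "A = (B :: complex mat)"
proof (rule eq_matI)
  fix i j assume "i < dim_row B" "j < dim_col B"
  then show "A $$ (i,j) = B $$ (i,j)"
    using arg_cong[OF assms(3), of "\<lambda>M. M $$ (i,j)"] assms(1,2) by simp
qed (use assms in auto)

lemma adjoint_mult_self_index:
  assumes "A \<in> carrier_mat n k" "i < k" "j < k"
  shows "(mat_adjoint A * A) $$ (i,j) = (\<Sum>r<n. cnj (A $$ (r,i)) * (A $$ (r,j) :: complex))"
  using assms by (auto simp: scalar_prod_def lessThan_atLeast0)

lemma mult_cnj_self: "cnj z * z = complex_of_real ((cmod z)\<^sup>2)"
  using complex_norm_square[of z] by (simp only: mult.commute)

lemma adjoint_mult_self_diag:
  assumes "A \<in> carrier_mat n k" "i < k"
  shows "(mat_adjoint A * A) $$ (i,i) = complex_of_real (\<Sum>r<n. (cmod (A $$ (r,i)))\<^sup>2)"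
proof -
  have "(mat_adjoint A * A) $$ (i,i) = (\<Sum>r<n. cnj (A $$ (r,i)) * A $$ (r,i))"
    by (rule adjoint_mult_self_index[OF assms assms(2)])
  also have "\<dots> = (\<Sum>r<n. complex_of_real ((cmod (A $$ (r,i)))\<^sup>2))"
    by (intro sum.cong refl mult_cnj_self)
  finally show ?thesis by simp
qed

text \<open>The diagonal entries of A^* A are the squared norms of the columns of A. Later
  equalities of operators are proved this way: expand X^* X for the difference X of the two sides
  and see everything cancel.\<close>

lemma adjoint_mult_self_eq_0:
  assumes A: "(A :: complex mat) \<in> carrier_mat n k" and "mat_adjoint A * A = 0\<^sub>m k k"
  shows "A = 0\<^sub>m n k"
proof (rule eq_matI)
  fix i j assume "i < dim_row (0\<^sub>m n k)" "j < dim_col (0\<^sub>m n k)"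
  then have ij: "i < n" "j < k" by auto
  have "(\<Sum>r<n. (cmod (A $$ (r,j)))\<^sup>2) = 0"
  proof -
    have "complex_of_real (\<Sum>r<n. (cmod (A $$ (r,j)))\<^sup>2) = 0"
      unfolding adjoint_mult_self_diag[OF A ij(2), symmetric] assms(2) using ij(2) by simp
    then show ?thesis by (simp only: of_real_eq_0_iff)
  qed
  with ij show "A $$ (i,j) = 0\<^sub>m n k $$ (i,j)"
    by (subst (asm) sum_nonneg_eq_0_iff) auto
qed (use A in auto)

lemma mult_mat_index_sum:
  assumes "A \<in> carrier_mat n k" "B \<in> carrier_mat k l" "i < n" "j < l"
  shows "(A * B) $$ (i,j) = (\<Sum>t<k. A $$ (i,t) * B $$ (t,j))"
  using assms by (auto simp: scalar_prod_def lessThan_atLeast0)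

text \<open>Entrywise, as the sums in \<open>kraus_family\<close> and \<open>kraus_map\<close> are
  written, so that both unfold to it; the dimension is an argument so that the empty sum has
  one.\<close>

definition mat_sum :: "nat \<Rightarrow> nat \<Rightarrow> (nat \<Rightarrow> complex mat) \<Rightarrow> complex mat" where
  "mat_sum n m F = mat n n (\<lambda>(r,s). \<Sum>i<m. F i $$ (r,s))"

lemma mat_sum_carrier [simp]: "mat_sum n m F \<in> carrier_mat n n"
  by (simp add: mat_sum_def)

lemma mat_sum_cong: "(\<And>i. i < m \<Longrightarrow> F i = G i) \<Longrightarrow> mat_sum n m F = mat_sum n m G"
  by (auto simp: mat_sum_def)

lemma mult_mat_sum:
  assumes "A \<in> carrier_mat n n" "\<And>i. i < m \<Longrightarrow> F i \<in> carrier_mat n n"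
  shows "A * mat_sum n m F = mat_sum n m (\<lambda>i. A * F i)"
proof (rule eq_matI)
  fix r s assume rs: "r < dim_row (mat_sum n m (\<lambda>i. A * F i))" "s < dim_col (mat_sum n m (\<lambda>i. A * F i))"
  then have rs: "r < n" "s < n" by (auto simp: mat_sum_def)
  have "(A * mat_sum n m F) $$ (r,s) = (\<Sum>t<n. \<Sum>i<m. A $$ (r,t) * F i $$ (t,s))"
    using rs assms by (auto simp: mat_sum_def scalar_prod_def sum_distrib_left lessThan_atLeast0)
  also have "\<dots> = (\<Sum>i<m. \<Sum>t<n. A $$ (r,t) * F i $$ (t,s))"
    by (rule sum.swap)
  also have "\<dots> = (\<Sum>i<m. (A * F i) $$ (r,s))"
    using rs assms by (intro sum.cong) (auto simp: mult_mat_index_sum[of _ n n _ n])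
  finally show "(A * mat_sum n m F) $$ (r,s) = mat_sum n m (\<lambda>i. A * F i) $$ (r,s)"
    using rs by (simp add: mat_sum_def)
qed (use assms in \<open>auto simp: mat_sum_def\<close>)

lemma mat_sum_mult:
  assumes "A \<in> carrier_mat n n" "\<And>i. i < m \<Longrightarrow> F i \<in> carrier_mat n n"
  shows "mat_sum n m F * A = mat_sum n m (\<lambda>i. F i * A)"
proof (rule eq_matI)
  fix r s assume rs: "r < dim_row (mat_sum n m (\<lambda>i. F i * A))" "s < dim_col (mat_sum n m (\<lambda>i. F i * A))"
  then have rs: "r < n" "s < n" by (auto simp: mat_sum_def)
  have "(mat_sum n m F * A) $$ (r,s) = (\<Sum>t<n. \<Sum>i<m. F i $$ (r,t) * A $$ (t,s))"
    using rs assms by (auto simp: mat_sum_def scalar_prod_def sum_distrib_right lessThan_atLeast0)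
  also have "\<dots> = (\<Sum>i<m. \<Sum>t<n. F i $$ (r,t) * A $$ (t,s))"
    by (rule sum.swap)
  also have "\<dots> = (\<Sum>i<m. (F i * A) $$ (r,s))"
    using rs assms by (intro sum.cong) (auto simp: mult_mat_index_sum[of _ n n _ n])
  finally show "(mat_sum n m F * A) $$ (r,s) = mat_sum n m (\<lambda>i. F i * A) $$ (r,s)"
    using rs by (simp add: mat_sum_def)
qed (use assms in \<open>auto simp: mat_sum_def\<close>)

lemma mat_sum_sandwich:
  assumes A: "A \<in> carrier_mat n n" and B: "B \<in> carrier_mat n n"
    and F: "\<And>i. i < m \<Longrightarrow> F i \<in> carrier_mat n n"
  shows "A * mat_sum n m F * B = mat_sum n m (\<lambda>i. A * F i * B)"
proof -
  have "A * mat_sum n m F * B = mat_sum n m (\<lambda>i. A * F i) * B"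
    using A F by (simp add: mult_mat_sum)
  also have "\<dots> = mat_sum n m (\<lambda>i. A * F i * B)"
    using A B F by (intro mat_sum_mult) auto
  finally show ?thesis .
qed

lemma mat_sum_smult:
  assumes "A \<in> carrier_mat n n"
  shows "mat_sum n m (\<lambda>i. c i \<cdot>\<^sub>m A) = (\<Sum>i<m. c i) \<cdot>\<^sub>m A"
  using assms by (intro eq_matI) (auto simp: mat_sum_def sum_distrib_right)

definition mat_trace :: "complex mat \<Rightarrow> complex" where
  "mat_trace A = (\<Sum>i<dim_row A. A $$ (i,i))"

lemma mat_trace_comm:
  assumes "A \<in> carrier_mat n k" "B \<in> carrier_mat k n"
  shows "mat_trace (A * B) = mat_trace (B * A)"
proof -
  have "mat_trace (A * B) = (\<Sum>i<n. \<Sum>j<k. A $$ (i,j) * B $$ (j,i))"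
    using assms by (auto simp: mat_trace_def scalar_prod_def lessThan_atLeast0 intro!: sum.cong)
  also have "\<dots> = (\<Sum>j<k. \<Sum>i<n. B $$ (j,i) * A $$ (i,j))"
    by (subst sum.swap) (simp add: mult.commute)
  also have "\<dots> = mat_trace (B * A)"
    using assms by (auto simp: mat_trace_def scalar_prod_def lessThan_atLeast0 intro!: sum.cong)
  finally show ?thesis .
qed

text \<open>Gram-Schmidt leaves the first vector in place and makes the others orthogonal without
  normalising, so dividing by the norms gives a unitary matrix. The factor \<open>c\<close> is the
  normalisation; it does no harm where \<open>v\<close> is an eigenvector.\<close>

lemma unitary_with_first_column:
  assumes v: "(v :: complex vec) \<in> carrier_vec n" and v0: "v \<noteq> 0\<^sub>v n"
  shows "\<exists>U c. unitary_mat n U \<and> col U 0 = c \<cdot>\<^sub>v v"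
proof -
  interpret cof_vec_space n "TYPE(complex)" .
  define ws where "ws = gram_schmidt n (basis_completion v)"
  note bc = basis_completion[OF v v0]
  note gs = gram_schmidt_result[OF bc(2,4,5) ws_def]
  have len: "length ws = n" using gs bc(6) by simp
  have wsc: "\<And>i. i < n \<Longrightarrow> ws ! i \<in> carrier_vec n" using gs len by (auto simp: subset_iff)
  have n: "0 < n" using v v0 by (cases n) auto
  have "basis_completion v = v # tl (basis_completion v)"
    using bc(6,7) n by (cases "basis_completion v") auto
  then have "hd ws = v"
    using gram_schmidt_hd[OF v, of "tl (basis_completion v)"] by (simp add: ws_def)
  then have ws0: "ws ! 0 = v" using len n by (metis hd_conv_nth length_greater_0_conv)
  define q where "q i = (\<Sum>r<n. (cmod (ws ! i $ r))\<^sup>2)" for i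
  define U where "U = mat n n (\<lambda>(r,i). ws ! i $ r / of_real (sqrt (q i)))"
  have U: "U \<in> carrier_mat n n" by (simp add: U_def)
  have dot: "(\<Sum>r<n. ws ! i $ r * cnj (ws ! j $ r)) = ws ! i \<bullet>c ws ! j" if "i < n" "j < n" for i j
    using wsc[OF that(1)] wsc[OF that(2)] by (auto simp: scalar_prod_def lessThan_atLeast0)
  have qq: "complex_of_real (q i) = ws ! i \<bullet>c ws ! i" if "i < n" for i
    unfolding dot[OF that that, symmetric] by (simp add: q_def complex_norm_square[symmetric])
  have q0: "q i \<noteq> 0" if "i < n" for i
    using corthogonalD[OF gs(2), of i i] that len qq[OF that] by auto
  have qpos: "q i > 0" if "i < n" for i
    using q0[OF that] by (simp add: q_def order_less_le sum_nonneg)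
  have UU: "mat_adjoint U * U = 1\<^sub>m n"
  proof (rule eq_matI)
    fix i j assume "i < dim_row (1\<^sub>m n)" "j < dim_col (1\<^sub>m n)"
    then have ij: "i < n" "j < n" by auto
    have "(mat_adjoint U * U) $$ (i,j)
        = (\<Sum>r<n. ws ! j $ r * cnj (ws ! i $ r)) / (of_real (sqrt (q i)) * of_real (sqrt (q j)))"
      unfolding adjoint_mult_self_index[OF U ij] sum_divide_distrib
      using ij by (intro sum.cong) (auto simp: U_def)
    also have "\<dots> = (if i = j then 1 else 0)"
    proof (cases "i = j")
      case True
      have "sqrt (q i) * sqrt (q i) = q i" using qpos[OF ij(1)] by simp
      then have "complex_of_real (sqrt (q i)) * of_real (sqrt (q i)) = of_real (q i)"
        by (metis of_real_mult)
      moreover have "(\<Sum>r<n. ws ! i $ r * cnj (ws ! i $ r)) = of_real (q i)"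
        using qq[OF ij(1)] dot[OF ij(1) ij(1)] by simp
      ultimately show ?thesis using True q0[OF ij(1)] by simp
    next
      case False
      then have "(\<Sum>r<n. ws ! j $ r * cnj (ws ! i $ r)) = 0"
        unfolding dot[OF ij(2,1)] by (subst corthogonalD[OF gs(2)]) (use ij len in simp_all)
      with False show ?thesis by simp
    qed
    finally show "(mat_adjoint U * U) $$ (i,j) = 1\<^sub>m n $$ (i,j)" using ij by simp
  qed (use U in auto)
  have "U * mat_adjoint U = 1\<^sub>m n"
    by (rule mat_mult_left_right_inverse[OF _ U UU]) (use U in simp)
  moreover have "col U 0 = (1 / of_real (sqrt (q 0))) \<cdot>\<^sub>v v"
    using v n ws0 by (intro eq_vecI) (auto simp: U_def)
  ultimately show ?thesis using U UU by (auto simp: unitary_mat_def)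
qed

section \<open>Unitary diagonalization\<close>

lemma mult_square_mat_carrier [simp]:
  "A \<in> carrier_mat n n \<Longrightarrow> B \<in> carrier_mat n n \<Longrightarrow> A * B \<in> carrier_mat n n"
  by (rule mult_carrier_mat)

lemma unitary_matD:
  assumes "unitary_mat n U"
  shows "U \<in> carrier_mat n n" "U * mat_adjoint U = 1\<^sub>m n" "mat_adjoint U * U = 1\<^sub>m n"
  using assms by (auto simp: unitary_mat_def)

lemma unitary_matI:
  assumes U: "U \<in> carrier_mat n n" and UU: "mat_adjoint U * U = 1\<^sub>m n"
  shows "unitary_mat n U"
  using mat_mult_left_right_inverse[OF mat_adjoint_carrier[OF U] U UU] assms
  by (simp add: unitary_mat_def)

lemma unitary_mat_adjoint: "unitary_mat n U \<Longrightarrow> unitary_mat n (mat_adjoint U)"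
  by (simp add: unitary_mat_def)

lemma unitary_mult_cancel:
  assumes "unitary_mat n U" "A \<in> carrier_mat n k"
  shows "mat_adjoint U * (U * A) = A" "U * (mat_adjoint U * A) = A"
  using unitary_matD[OF assms(1)] assms(2)
  by (simp_all add: assoc_mult_mat[of _ n n _ n _ k, symmetric])

lemma unitary_mat_mult:
  assumes U: "unitary_mat n U" and V: "unitary_mat n V"
  shows "unitary_mat n (U * V)"
proof (rule unitary_matI)
  note c = unitary_matD(1)[OF U] unitary_matD(1)[OF V]
  show "U * V \<in> carrier_mat n n" using c by simp
  show "mat_adjoint (U * V) * (U * V) = 1\<^sub>m n"
    using c unitary_mult_cancel[OF U c(2)] unitary_matD[OF V]
    by (simp add: mat_adjoint_mult[of _ n n _ n] assoc_mult_mat[of _ n n _ n _ n])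
qed

lemma unitary_conjugate:
  assumes U: "unitary_mat n U" and A: "A \<in> carrier_mat n n"
  shows "U * (mat_adjoint U * A * U) * mat_adjoint U = A"
proof -
  note c = unitary_matD[OF U]
  have "U * (mat_adjoint U * A * U) * mat_adjoint U = U * (mat_adjoint U * A) * (U * mat_adjoint U)"
    using c(1) A by (simp add: assoc_mult_mat[of _ n n _ n _ n])
  then show ?thesis using unitary_mult_cancel(2)[OF U A] c A by simp
qed

text \<open>Deflation: an eigenvector as first column of a unitary splits off one eigenvalue. The
  list \<open>es\<close> is prescribed rather than produced, so the eigenvalues may be taken in any
  order; this lets two projections with the same spectrum be brought to literally the same diagonal
  matrix.\<close>

lemma hermitian_unitary_diagonalization:
  fixes A :: "complex mat"
  assumes "A \<in> carrier_mat n n" "mat_adjoint A = A"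
    and "char_poly A = (\<Prod>e\<leftarrow>es. [:- e, 1:])"
  shows "\<exists>U. unitary_mat n U \<and> A = U * mat_diag n ((!) es) * mat_adjoint U"
  using assms
proof (induction es arbitrary: n A)
  case Nil
  then have n: "n = 0" using degree_monic_char_poly[of A n] by simp
  have "unitary_mat n (1\<^sub>m n)" by (simp add: unitary_mat_def)
  moreover have "A = 1\<^sub>m n * mat_diag n ((!) []) * mat_adjoint (1\<^sub>m n)"
    using Nil(1) n by (intro eq_matI) auto
  ultimately show ?case by blast
next
  case (Cons e es)
  note A = Cons.prems(1)
  have "degree (char_poly A) = Suc (length es)"
    using degree_linear_factors[of uminus "e # es"] Cons.prems(3) by simp
  then have n: "n = Suc (length es)" using degree_monic_char_poly[OF A] by simp
  define k where "k = length es"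
  have nk: "n = Suc k" by (simp add: n k_def)
  have "eigenvalue A e" unfolding eigenvalue_root_char_poly[OF A] Cons.prems(3) by simp
  then obtain v where v: "v \<in> carrier_vec n" "v \<noteq> 0\<^sub>v n" "A *\<^sub>v v = e \<cdot>\<^sub>v v"
    using A by (auto simp: eigenvalue_def eigenvector_def)
  then obtain U c where U: "unitary_mat n U" and U0: "col U 0 = c \<cdot>\<^sub>v v"
    using unitary_with_first_column by blast
  note Uc = unitary_matD(1)[OF U]
  define A' where "A' = mat_adjoint U * A * U"
  have A': "A' \<in> carrier_mat n n" using Uc A by (simp add: A'_def)
  have herm: "mat_adjoint A' = A'"
    using Uc A Cons.prems(2)
    by (simp add: A'_def mat_adjoint_mult[of _ n n _ n] assoc_mult_mat[of _ n n _ n _ n])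
  have "A *\<^sub>v col U 0 = e \<cdot>\<^sub>v col U 0"
    using A v by (simp add: U0 mult_mat_vec smult_smult_assoc mult.commute)
  then have "col (A * U) 0 = e \<cdot>\<^sub>v col U 0"
    by (subst col_mult2[OF A Uc]) (use nk in simp_all)
  then have "col A' 0 = mat_adjoint U *\<^sub>v (e \<cdot>\<^sub>v col U 0)"
    using A Uc nk by (simp add: A'_def assoc_mult_mat[of _ n n _ n _ n] col_mult2[of _ n n _ n])
  also have "\<dots> = e \<cdot>\<^sub>v (mat_adjoint U *\<^sub>v col U 0)"
    using Uc by (intro mult_mat_vec[of _ n n]) auto
  also have "mat_adjoint U *\<^sub>v col U 0 = col (mat_adjoint U * U) 0"
    using Uc nk by (subst col_mult2[of _ n n _ n]) auto
  also have "\<dots> = unit_vec n 0" using unitary_matD(3)[OF U] nk by simp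
  finally have col_A': "col A' 0 = e \<cdot>\<^sub>v unit_vec n 0" .
  have col0: "A' $$ (i,0) = (if i = 0 then e else 0)" if "i < n" for i
  proof -
    have "A' $$ (i,0) = col A' 0 $ i" using that A' nk by simp
    then show ?thesis using that nk by (simp add: col_A')
  qed
  \<comment> \<open>Hermitian symmetry clears the first row along with the first column, so the
    matrix is block diagonal and not merely block triangular.\<close>
  have row0: "A' $$ (0,i) = (if i = 0 then e else 0)" if "i < n" for i
  proof (cases "i = 0")
    case False
    have "A' $$ (0,i) = cnj (A' $$ (i,0))"
      using that A' nk by (subst herm[symmetric]) simp
    then show ?thesis using False col0[OF that] by simp
  qed (use col0 that in auto)
  define A3 where "A3 = mat k k (\<lambda>(i,j). A' $$ (Suc i, Suc j))"
  define E where "E = mat 1 1 (\<lambda>_. e)"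
  have A3: "A3 \<in> carrier_mat k k" by (simp add: A3_def)
  have E: "E \<in> carrier_mat 1 1" by (simp add: E_def)
  have A'_block: "A' = four_block_mat E (0\<^sub>m 1 k) (0\<^sub>m k 1) A3"
    using A' nk col0 row0 by (intro eq_matI) (auto simp: A3_def E_def)
  \<comment> \<open>Similarity carries the prescribed factorisation over to \<open>A'\<close>;
    cancelling the linear factor of the 1 by 1 block leaves the factorisation required by the
    induction hypothesis for \<open>A3\<close>.\<close>
  have "similar_mat A' A"
    unfolding similar_mat_def using unitary_matD[OF U] A
    by (intro exI[of _ "mat_adjoint U"] exI[of _ U] similar_mat_witI[of _ _ n]) (auto simp: A'_def)
  then have "char_poly A' = (\<Prod>e\<leftarrow>e # es. [:- e, 1:])"
    using char_poly_similar Cons.prems(3) by metis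
  then have "char_poly E * char_poly A3 = (\<Prod>e\<leftarrow>e # es. [:- e, 1:])"
    unfolding A'_block char_poly_four_block_zeros_col[OF E zero_carrier_mat A3] .
  moreover have "char_poly E = [:- e, 1:]"
    by (simp add: E_def char_poly_defs det_def sign_def)
  ultimately have "[:- e, 1:] * char_poly A3 = [:- e, 1:] * (\<Prod>e\<leftarrow>es. [:- e, 1:])"
    by (simp only: list.map prod_list.Cons)
  then have "char_poly A3 = (\<Prod>e\<leftarrow>es. [:- e, 1:])"
    by (subst (asm) mult_left_cancel) auto
  moreover have "mat_adjoint A3 = A3"
  proof (rule eq_matI)
    fix i j assume "i < dim_row A3" "j < dim_col A3"
    then have ij: "Suc i < n" "Suc j < n" "i < k" "j < k" using A3 nk by auto
    have "cnj (A' $$ (Suc j, Suc i)) = A' $$ (Suc i, Suc j)"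
      using ij A' by (subst (2) herm[symmetric]) simp
    then show "mat_adjoint A3 $$ (i,j) = A3 $$ (i,j)" using ij by (simp add: A3_def)
  qed (use A3 in auto)
  ultimately obtain V where V: "unitary_mat k V" and A3V: "A3 = V * mat_diag k ((!) es) * mat_adjoint V"
    using Cons.IH[OF A3] by blast
  note Vc = unitary_matD(1)[OF V]
  define W where "W = four_block_mat (1\<^sub>m 1) (0\<^sub>m 1 k) (0\<^sub>m k 1) V"
  have Wc: "W \<in> carrier_mat n n"
    unfolding W_def using four_block_carrier_mat[OF one_carrier_mat Vc, of 1] nk by simp
  have Wadj: "mat_adjoint W = four_block_mat (1\<^sub>m 1) (0\<^sub>m 1 k) (0\<^sub>m k 1) (mat_adjoint V)"
    unfolding W_def using Vc by (intro eq_matI) auto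
  have "mat_adjoint W * W = four_block_mat (1\<^sub>m 1) (0\<^sub>m 1 k) (0\<^sub>m k 1) (1\<^sub>m k)"
    unfolding Wadj using Vc unitary_matD(3)[OF V]
    unfolding W_def
    by (subst mult_four_block_mat[of _ 1 1 _ k _ k _ _ 1 _ k]) auto
  also have "\<dots> = 1\<^sub>m n" using nk by (intro eq_matI) auto
  finally have W: "unitary_mat n W" using Wc by (intro unitary_matI)
  have D: "mat_diag n ((!) (e # es)) = four_block_mat E (0\<^sub>m 1 k) (0\<^sub>m k 1) (mat_diag k ((!) es))"
    using nk by (intro eq_matI) (auto simp: mat_diag_def E_def nth_Cons')
  have "W * mat_diag n ((!) (e # es)) = four_block_mat E (0\<^sub>m 1 k) (0\<^sub>m k 1) (V * mat_diag k ((!) es))"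
    unfolding D W_def using Vc E
    by (subst mult_four_block_mat[of _ 1 1 _ k _ k _ _ 1 _ k]) (auto simp: left_mult_zero_mat[of _ k k])
  then have "W * mat_diag n ((!) (e # es)) * mat_adjoint W = A'"
    unfolding A'_block Wadj A3V using Vc E
    by (simp, subst mult_four_block_mat[of _ 1 1 _ k _ k _ _ 1 _ k])
      (auto simp: right_mult_zero_mat[of _ k k] left_add_zero_mat[of _ k k])
  then have "A = U * (W * mat_diag n ((!) (e # es)) * mat_adjoint W) * mat_adjoint U"
    using unitary_conjugate[OF U A] by (simp add: A'_def)
  also have "\<dots> = (U * W) * mat_diag n ((!) (e # es)) * mat_adjoint (U * W)"
    using Uc Wc by (simp add: mat_adjoint_mult[of _ n n _ n] assoc_mult_mat[of _ n n _ n _ n])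
  finally show ?case using unitary_mat_mult[OF U W] by blast
qed

lemma diag_of_unitary_form:
  assumes U: "unitary_mat n U" and A: "A = U * mat_diag n d * mat_adjoint U"
  shows "mat_adjoint U * A * U = mat_diag n d" "mat_trace A = (\<Sum>i<n. d i)"
    "A * A = U * mat_diag n (\<lambda>i. d i * d i) * mat_adjoint U"
proof -
  note Uc = unitary_matD[OF U]
  show D: "mat_adjoint U * A * U = mat_diag n d"
    unfolding A using unitary_conjugate[OF unitary_mat_adjoint[OF U], of "mat_diag n d"] by simp
  have "mat_trace A = mat_trace (mat_adjoint U * (U * mat_diag n d))"
    unfolding A using Uc(1) by (intro mat_trace_comm[of _ n n]) auto
  also have "\<dots> = mat_trace (mat_diag n d)" by (subst unitary_mult_cancel(1)[OF U, of _ n]) auto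
  also have "\<dots> = (\<Sum>i<n. d i)" by (simp add: mat_trace_def mat_diag_def)
  finally show "mat_trace A = (\<Sum>i<n. d i)" .
  have "A * A = U * (mat_diag n d * (mat_adjoint U * (U * (mat_diag n d * mat_adjoint U))))"
    unfolding A using Uc(1) by (simp add: assoc_mult_mat[of _ n n _ n _ n])
  also have "mat_adjoint U * (U * (mat_diag n d * mat_adjoint U)) = mat_diag n d * mat_adjoint U"
    using Uc(1) by (intro unitary_mult_cancel(1)[OF U, of _ n]) auto
  also have "mat_diag n d * (mat_diag n d * mat_adjoint U) = mat_diag n (\<lambda>i. d i * d i) * mat_adjoint U"
    using Uc(1) by (subst assoc_mult_mat[of _ n n _ n _ n, symmetric]) auto
  finally show "A * A = U * mat_diag n (\<lambda>i. d i * d i) * mat_adjoint U"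
    using Uc(1) by (simp add: assoc_mult_mat[of _ n n _ n _ n])
qed

section \<open>Projections and partial isometries\<close>

lemma mset_eq_of_zero_one_lists:
  fixes xs ys :: "complex list"
  assumes "set xs \<subseteq> {0,1}" "set ys \<subseteq> {0,1}" "length xs = length ys" "sum_list xs = sum_list ys"
  shows "mset xs = mset ys"
proof -
  \<comment> \<open>In a list of zeros and ones the sum counts the ones and the length counts both
    values, so the two numbers fix both multiplicities.\<close>
  have one: "sum_list zs = of_nat (count (mset zs) 1)"
    and two: "length zs = count (mset zs) 0 + count (mset zs) 1"
    and rest: "x \<noteq> 0 \<Longrightarrow> x \<noteq> 1 \<Longrightarrow> count (mset zs) x = 0"
    if "set zs \<subseteq> {0,1}" for zs :: "complex list" and x
    using that by (induction zs) auto
  have 1: "count (mset xs) 1 = count (mset ys) 1"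
    using assms(4) unfolding one[OF assms(1)] one[OF assms(2)] by (simp only: of_nat_eq_iff)
  then have 0: "count (mset xs) 0 = count (mset ys) 0"
    using assms(3) two[OF assms(1)] two[OF assms(2)] by simp
  show ?thesis
  proof (rule multiset_eqI)
    fix x :: complex
    consider "x = 0" | "x = 1" | "x \<noteq> 0" "x \<noteq> 1" by blast
    then show "count (mset xs) x = count (mset ys) x"
    proof cases
      case 3
      from rest[OF assms(1) this] rest[OF assms(2) this] show ?thesis by (simp only:)
    qed (simp_all only: 0 1)
  qed
qed

lemma orth_projection_diagonal:
  assumes "orth_projection n P"
  shows "\<exists>es U. length es = n \<and> set es \<subseteq> {0,1} \<and> char_poly P = (\<Prod>e\<leftarrow>es. [:- e, 1:])
    \<and> unitary_mat n U \<and> P = U * mat_diag n ((!) es) * mat_adjoint U \<and> mat_trace P = sum_list es"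
proof -
  have P: "P \<in> carrier_mat n n" "P * P = P" "mat_adjoint P = P"
    using assms by (auto simp: orth_projection_def)
  obtain es where es: "char_poly P = (\<Prod>e\<leftarrow>es. [:- e, 1:])" "length es = n"
    using char_poly_factorized[OF P(1)] by blast
  obtain U where U: "unitary_mat n U" and PU: "P = U * mat_diag n ((!) es) * mat_adjoint U"
    using hermitian_unitary_diagonalization[OF P(1,3) es(1)] by blast
  note d = diag_of_unitary_form[OF U PU] and Uc = unitary_matD(1)[OF U]
  \<comment> \<open>Idempotence gives \<open>P\<close> a second diagonal form under the same
    \<open>U\<close>, with squared entries. Conjugating back and comparing entries gives
    \<open>e = e * e\<close>.\<close>
  have "P = U * mat_diag n (\<lambda>i. es ! i * es ! i) * mat_adjoint U" using d(3) P(2) by simp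
  from diag_of_unitary_form(1)[OF U this] d(1)
  have D: "mat_diag n ((!) es) = mat_diag n (\<lambda>i. es ! i * es ! i)" by simp
  have "e \<in> {0,1}" if "e \<in> set es" for e
  proof -
    obtain i where i: "i < n" "e = es ! i" using \<open>e \<in> set es\<close> es(2) by (auto simp: in_set_conv_nth)
    have "e = e * e" using arg_cong[OF D, of "\<lambda>M. M $$ (i,i)"] i by (simp add: mat_diag_def)
    then show ?thesis by auto
  qed
  moreover have "mat_trace P = sum_list es"
    using d(2) es(2) by (simp add: sum_list_sum_nth lessThan_atLeast0)
  ultimately show ?thesis using es U PU by blast
qed

lemma projections_unitarily_equivalent:
  assumes P: "orth_projection n P" and Q: "orth_projection n Q" and tr: "mat_trace P = mat_trace Q"
  shows "\<exists>X. unitary_mat n X \<and> X * P = Q * X"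
proof -
  obtain es A where es: "length es = n" "set es \<subseteq> {0,1}" "char_poly P = (\<Prod>e\<leftarrow>es. [:- e, 1:])"
    "mat_trace P = sum_list es"
    and A: "unitary_mat n A" "P = A * mat_diag n ((!) es) * mat_adjoint A"
    using orth_projection_diagonal[OF P] by blast
  obtain fs where fs: "length fs = n" "set fs \<subseteq> {0,1}" "char_poly Q = (\<Prod>e\<leftarrow>fs. [:- e, 1:])"
    "mat_trace Q = sum_list fs"
    using orth_projection_diagonal[OF Q] by blast
  \<comment> \<open>Both lists have length \<open>n\<close> and the common trace as sum. Hence the
    characteristic polynomial of \<open>Q\<close> factors along \<open>es\<close> too, and
    \<open>Q\<close> can be diagonalised with the eigenvalues in the order used for
    \<open>P\<close>; the product of the two diagonalising unitaries then intertwines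
    \<open>P\<close> and \<open>Q\<close>.\<close>
  have "mset fs = mset es" using es fs tr by (intro mset_eq_of_zero_one_lists) auto
  then have "mset (map (\<lambda>e. [:- e, 1:]) fs) = mset (map (\<lambda>e. [:- e, 1:]) es)" by simp
  then have "char_poly Q = (\<Prod>e\<leftarrow>es. [:- e, 1:])"
    unfolding fs(3) by (simp only: prod_mset_prod_list[symmetric])
  then obtain B where B: "unitary_mat n B" "Q = B * mat_diag n ((!) es) * mat_adjoint B"
    using hermitian_unitary_diagonalization Q unfolding orth_projection_def by blast
  let ?D = "mat_diag n ((!) es)"
  note Ac = unitary_matD(1)[OF A(1)] and Bc = unitary_matD(1)[OF B(1)]
  have "B * mat_adjoint A * P = B * (mat_adjoint A * (A * (?D * mat_adjoint A)))"
    unfolding A(2) using Ac Bc by (simp add: assoc_mult_mat[of _ n n _ n _ n])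
  also have "\<dots> = B * (?D * mat_adjoint A)"
    using Ac by (subst unitary_mult_cancel(1)[OF A(1), of _ n]) auto
  also have "\<dots> = B * (?D * (mat_adjoint B * (B * mat_adjoint A)))"
    using Ac by (subst unitary_mult_cancel(1)[OF B(1), of _ n]) auto
  also have "\<dots> = Q * (B * mat_adjoint A)"
    unfolding B(2) using Ac Bc by (simp add: assoc_mult_mat[of _ n n _ n _ n])
  finally show ?thesis
    using unitary_mat_mult[OF B(1) unitary_mat_adjoint[OF A(1)]] by blast
qed

lemma partial_isometry_extends:
  assumes W: "W \<in> carrier_mat n n" and P: "orth_projection n P" and WW: "mat_adjoint W * W = P"
  shows "\<exists>V. unitary_mat n V \<and> V * P = W"
proof -
  have Pc: "P \<in> carrier_mat n n" and PP: "P * P = P" and Pa: "mat_adjoint P = P"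
    using P by (auto simp: orth_projection_def)
  note alg = assoc_mult_mat[of _ n n _ n _ n] minus_mult_distrib_mat[of _ n n _ _ n]
    mult_minus_distrib_mat[of _ n n _ n] add_mult_distrib_mat[of _ n n _ _ n]
    mult_add_distrib_mat[of _ n n _ n] mat_adjoint_mult[of _ n n _ n]
    mat_adjoint_minus[of _ n n] mat_adjoint_add[of _ n n]
    minus_carrier_mat
  have WWA: "mat_adjoint W * (W * A) = P * A" if "A \<in> carrier_mat n n" for A
    using W that by (simp add: assoc_mult_mat[of _ n n _ n _ n, symmetric] WW)
  have PPA: "P * (P * A) = P * A" if "A \<in> carrier_mat n n" for A
    using Pc that by (simp add: assoc_mult_mat[of _ n n _ n _ n, symmetric] PP)
  \<comment> \<open>This shows that \<open>W\<close> vanishes on the kernel of \<open>P\<close>: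
    with W^* W = P, the product Z^* Z expands to P - P - P + P.\<close>
  define Z where "Z = W - W * P"
  have Zc: "Z \<in> carrier_mat n n" unfolding Z_def by (rule minus_carrier_mat) (use W Pc in simp)
  have "mat_adjoint Z * Z = 0\<^sub>m n n"
    using W Pc by (simp add: Z_def alg WW WWA PP PPA Pa)
  then have "Z = 0\<^sub>m n n" by (rule adjoint_mult_self_eq_0[OF Zc])
  then have WP: "W * P = W"
    using minus_mat_eq_0D[of W n n "W * P"] W Pc by (simp add: Z_def)
  define Q where "Q = W * mat_adjoint W"
  have Qc: "Q \<in> carrier_mat n n" using W by (simp add: Q_def)
  have QW: "Q * W = W" using W by (simp add: Q_def alg WW WP)
  have Q: "orth_projection n Q"
  proof -
    have "Q * Q = (Q * W) * mat_adjoint W" using W Qc by (simp add: Q_def alg)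
    then have "Q * Q = Q" unfolding QW by (simp only: Q_def)
    moreover have "mat_adjoint Q = Q" using W by (simp add: Q_def alg)
    ultimately show ?thesis using Qc by (simp add: orth_projection_def)
  qed
  have "mat_trace P = mat_trace Q"
    unfolding Q_def WW[symmetric] using W by (intro mat_trace_comm[of _ n n]) auto
  then obtain X where X: "unitary_mat n X" and XP: "X * P = Q * X"
    using projections_unitarily_equivalent[OF P Q] by metis
  note Xc = unitary_matD[OF X]
  \<comment> \<open>\<open>Y\<close> is X (1 - P). It kills the range of \<open>P\<close>, and since
    \<open>X\<close> intertwines \<open>P\<close> with \<open>Q\<close>, its range is orthogonal to
    that of \<open>W\<close>. The cross terms of (W + Y)^* (W + Y) therefore vanish, and P + (1 - P)
    remains.\<close>
  define Y where "Y = X - X * P"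
  have Yc: "Y \<in> carrier_mat n n" unfolding Y_def by (rule minus_carrier_mat) (use Xc Pc in simp)
  have YP: "Y * P = 0\<^sub>m n n" using Xc Pc by (simp add: Y_def alg PP)
  have QY: "Q * Y = 0\<^sub>m n n"
  proof -
    have "Q * Y = Q * X - Q * X * P" using Xc Pc Qc by (simp add: Y_def alg)
    also have "\<dots> = X * P - X * P" unfolding XP[symmetric] using Xc Pc by (simp add: alg PP)
    also have "\<dots> = 0\<^sub>m n n" using Xc Pc by (intro minus_r_inv_mat) auto
    finally show ?thesis .
  qed
  have WQ: "mat_adjoint W = mat_adjoint W * Q"
    using arg_cong[OF QW, of mat_adjoint] W Qc Q by (simp add: alg orth_projection_def)
  have WY: "mat_adjoint W * Y = 0\<^sub>m n n"
  proof -
    have "mat_adjoint W * Y = (mat_adjoint W * Q) * Y"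
      by (rule arg_cong[OF WQ])
    also have "\<dots> = mat_adjoint W * (Q * Y)" using W Qc Yc by (intro assoc_mult_mat[of _ n n _ n _ n]) auto
    finally show ?thesis using W by (simp add: QY right_mult_zero_mat[of _ n n])
  qed
  have "mat_adjoint (0\<^sub>m n n :: complex mat) = 0\<^sub>m n n" by (rule eq_matI) auto
  then have YW: "mat_adjoint Y * W = 0\<^sub>m n n"
    using arg_cong[OF WY, of mat_adjoint] W Yc by (simp add: alg)
  have YY: "mat_adjoint Y * Y = 1\<^sub>m n - P"
  proof -
    have "mat_adjoint Y * Y = 1\<^sub>m n - P - (P - P)"
      using Xc Pc unitary_mult_cancel(1)[OF X, of P n] by (simp add: Y_def alg Pa PP PPA)
    also have "\<dots> = 1\<^sub>m n - P" using Pc by (intro eq_matI) auto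
    finally show ?thesis .
  qed
  have "mat_adjoint (W + Y) * (W + Y) = P + 0\<^sub>m n n + (0\<^sub>m n n + (1\<^sub>m n - P))"
    using W Yc Pc by (simp add: alg WW WY YW YY)
  also have "\<dots> = 1\<^sub>m n" using Pc by (intro eq_matI) auto
  finally have "unitary_mat n (W + Y)" using W Yc by (intro unitary_matI) auto
  moreover have "(W + Y) * P = W" using W Yc Pc by (simp add: alg WP YP)
  ultimately show ?thesis by (intro exI[of _ "W + Y"] conjI)
qed

section \<open>Rank\<close>

context vec_space
begin

text \<open>Each column of \<open>A * B\<close> is \<open>A\<close> applied to a column of
  \<open>B\<close>, so the column spaces are nested.\<close>

lemma rank_mult_left_le:
  assumes A: "A \<in> carrier_mat n k" and B: "B \<in> carrier_mat k l"
  shows "rank (A * B) \<le> rank A"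
proof -
  have cA: "set (cols A) \<subseteq> carrier_vec n" and cAB: "set (cols (A * B)) \<subseteq> carrier_vec n"
    using A B by (auto simp: cols_def)
  have "set (cols (A * B)) \<subseteq> span (set (cols A))"
  proof
    fix y assume "y \<in> set (cols (A * B))"
    then obtain j where j: "j < l" "y = col (A * B) j" using B by (auto simp: cols_def)
    then have "y = A *\<^sub>v col B j" using col_mult2[OF A B j(1)] by (simp only:)
    then show "y \<in> span (set (cols A))"
      using A B j col_space_eq[OF A] unfolding col_space_def by (auto intro!: bexI[of _ "col B j"])
  qed
  then have sub: "span (set (cols (A * B))) \<subseteq> span (set (cols A))"
    using cA by (intro span_is_subset span_is_submodule)
  have V: "vectorspace class_ring (span_vs (set (cols A)))"
    using span_is_subspace[OF cA] subspace_is_vs by auto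
  have "VectorSpace.subspace class_ring (span (set (cols (A * B)))) (span_vs (set (cols A)))"
    using nested_subspaces[OF span_is_subspace[OF cA] span_is_subspace[OF cAB] sub] .
  then have "vectorspace.dim class_ring (span_vs (set (cols A))\<lparr>carrier := span (set (cols (A * B)))\<rparr>)
      \<le> vectorspace.dim class_ring (span_vs (set (cols A)))"
    using fin_dim_span_cols[OF A] fin_dim_span_cols[of "A * B" l] A B
    by (intro vectorspace.subspace_dim[OF V]) auto
  then show ?thesis by (simp add: rank_def)
qed

lemma rank_mult_le_inner_dim:
  assumes "A \<in> carrier_mat n k" "B \<in> carrier_mat k l"
  shows "rank (A * B) \<le> k"
  using rank_mult_left_le[OF assms] rank_le_nc[OF assms(1)] by simp

text \<open>The columns of \<open>C\<close> form a maximal independent set of columns of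
  \<open>A\<close>, and \<open>D\<close> holds the coordinates of all columns with respect to it.
  With the preceding bound this turns rank into the least inner dimension of a factorisation, a
  notion that does not refer to the ambient space.\<close>

lemma rank_factorization:
  assumes A: "A \<in> carrier_mat n k"
  shows "\<exists>C D. C \<in> carrier_mat n (rank A) \<and> D \<in> carrier_mat (rank A) k \<and> A = C * D"
proof -
  have cA: "set (cols A) \<subseteq> carrier_vec n" using A by (auto simp: cols_def)
  obtain S where S: "maximal S (\<lambda>T. T \<subseteq> set (cols A) \<and> lin_indpt T)" "finite S"
    using maximal_exists_superset[of "set (cols A)" "\<lambda>T. T \<subseteq> set (cols A) \<and> lin_indpt T" "{}"]
      finite_lin_indpt2[of "{}"] by auto
  have rank: "rank A = card S" by (rule rank_card_indpt[OF A S(1)])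
  have SA: "S \<subseteq> set (cols A)" "lin_indpt S" using S(1) by (auto simp: maximal_def)
  obtain cs where cs: "set cs = S" "distinct cs" using finite_distinct_list[OF S(2)] by blast
  have len: "length cs = rank A" using cs rank distinct_card by metis
  define C where "C = mat_of_cols n cs"
  have C: "C \<in> carrier_mat n (rank A)" by (simp add: C_def len[symmetric])
  have csc: "set cs \<subseteq> carrier_vec n" using SA cA cs by auto
  have "\<exists>x. x \<in> carrier_vec (rank A) \<and> col A j = C *\<^sub>v x" if "j < k" for j
  proof -
    have aj: "col A j \<in> set (cols A)" using A that by (auto simp: cols_def)
    have "col A j \<in> span S"
    proof (rule ccontr)
      assume out: "col A j \<notin> span S"
      have cS: "S \<subseteq> carrier_vec n" using SA cA by auto
      have notin: "col A j \<notin> S" using out span_mem[OF cS] by auto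
      have "lin_indpt (insert (col A j) S)"
        using lin_dep_iff_in_span[OF cS SA(2) _ notin] out aj cA by auto
      then have "insert (col A j) S \<subseteq> S"
        using S(1) aj SA unfolding maximal_def by blast
      then show False using notin by auto
    qed
    then have "col A j \<in> span_list cs" using span_list_as_span[OF csc] cs by simp
    then obtain c where "col A j = lincomb_list c cs" by (rule in_span_listE)
    also have "\<dots> = C *\<^sub>v vec (rank A) c"
      unfolding C_def len[symmetric] using csc by (intro lincomb_list_as_mat_mult) auto
    finally show ?thesis by (intro exI[of _ "vec (rank A) c"]) auto
  qed
  then obtain x where x: "\<And>j. j < k \<Longrightarrow> x j \<in> carrier_vec (rank A) \<and> col A j = C *\<^sub>v x j" by metis
  define D where "D = mat_of_cols (rank A) (map x [0..<k])"
  have D: "D \<in> carrier_mat (rank A) k"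
    using mat_of_cols_carrier(1)[of "rank A" "map x [0..<k]"] by (simp add: D_def)
  have "A = C * D"
  proof (rule mat_col_eqI)
    fix j assume "j < dim_col (C * D)"
    then have j: "j < k" using D by simp
    then have "col D j = x j" unfolding D_def using x by (subst col_mat_of_cols) auto
    then show "col A j = col (C * D) j" using x[OF j] col_mult2[OF C D j] by (simp only:)
  qed (use A C D in auto)
  then show ?thesis using C D by blast
qed

end

text \<open>The two ranks are computed in spaces of different dimension, so their column spaces
  cannot be compared directly. Splitting \<open>B\<close> through inner dimension
  \<open>rank B\<close> splits the whole product through the same inner dimension.\<close>

lemma rank_mult_mid_le:
  fixes B :: "complex mat"
  assumes A: "A \<in> carrier_mat n k" and B: "B \<in> carrier_mat k l" and C: "C \<in> carrier_mat l q"
  shows "vec_space.rank n (A * B * C) \<le> vec_space.rank k B"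
proof -
  interpret K: vec_space "TYPE(complex)" k .
  interpret V: vec_space "TYPE(complex)" n .
  obtain X Y where X: "X \<in> carrier_mat k (K.rank B)" and Y: "Y \<in> carrier_mat (K.rank B) l"
    and B_eq: "B = X * Y"
    using K.rank_factorization[OF B] by blast
  have AX: "A * X \<in> carrier_mat n (K.rank B)" and YC: "Y * C \<in> carrier_mat (K.rank B) q"
    using A X Y C by auto
  have "A * B * C = (A * X) * (Y * C)"
  proof -
    have "A * B * C = (A * X * Y) * C"
      using assoc_mult_mat[OF A X Y] by (simp only: B_eq)
    also have "\<dots> = (A * X) * (Y * C)" by (rule assoc_mult_mat[OF AX Y C])
    finally show ?thesis .
  qed
  then show ?thesis using V.rank_mult_le_inner_dim[OF AX YC] by simp
qed

lemma rank_one_mat: "vec_space.rank k (1\<^sub>m k :: complex mat) = k"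
proof -
  interpret vec_space "TYPE(complex)" k .
  show ?thesis using det_rank_iff[of "1\<^sub>m k"] by simp
qed

text \<open>Let \<open>f\<close> enumerate the \<open>k\<close> positions of the nonzero entries.
  The matrix \<open>S\<close> selects these positions and \<open>T\<close> divides by the entries,
  so compressing the diagonal matrix gives the identity of size \<open>k\<close>, whence the lower
  bound. The upper bound comes from the factorisation \<open>R * S\<close>, with inner dimension
  \<open>k\<close>.\<close>

lemma rank_mat_diag:
  fixes d :: "nat \<Rightarrow> complex"
  shows "vec_space.rank n (mat_diag n d) = card {i. i < n \<and> d i \<noteq> 0}"
proof -
  define k where "k = card {i. i < n \<and> d i \<noteq> 0}"
  obtain f where f: "bij_betw f {..<k} {i. i < n \<and> d i \<noteq> 0}"
    using ex_bij_betw_nat_finite[of "{i. i < n \<and> d i \<noteq> 0}"] by (auto simp: k_def lessThan_atLeast0)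
  have fn: "f a < n" "d (f a) \<noteq> 0" if "a < k" for a
    using bij_betwE[OF f] that by auto
  have inj: "f a = f b \<longleftrightarrow> a = b" if "a < k" "b < k" for a b
    using bij_betw_imp_inj_on[OF f] that by (auto simp: inj_on_def)
  have surj: "\<exists>a<k. i = f a" if "i < n" "d i \<noteq> 0" for i
    using bij_betw_imp_surj_on[OF f] that by (auto simp: image_iff dest!: equalityD2)
  define S where "S = mat k n (\<lambda>(a,i). if i = f a then 1 else 0 :: complex)"
  define T where "T = mat n k (\<lambda>(i,a). if i = f a then 1 / d i else 0)"
  define R where "R = mat n k (\<lambda>(i,a). if i = f a then d i else 0)"
  have c: "S \<in> carrier_mat k n" "T \<in> carrier_mat n k" "R \<in> carrier_mat n k"
    by (auto simp: S_def T_def R_def)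
  have "S * mat_diag n d * T = 1\<^sub>m k"
  proof (rule eq_matI)
    fix a b assume "a < dim_row (1\<^sub>m k)" "b < dim_col (1\<^sub>m k)"
    then have ab: "a < k" "b < k" by auto
    have "(S * mat_diag n d * T) $$ (a,b)
        = (\<Sum>i<n. (if i = f a then 1 else 0) * d i * (if i = f b then 1 / d i else 0))"
      unfolding mat_diag_mult_right[OF c(1)] using ab c(2)
      by (subst mult_mat_index_sum[of _ k n _ k]) (auto simp: S_def T_def simp del: index_mult_mat intro!: sum.cong)
    also have "\<dots> = (\<Sum>i<n. if i = f a then if f a = f b then 1 else 0 else 0)"
      using fn[OF ab(1)] by (intro sum.cong) auto
    also have "\<dots> = (if a = b then 1 else 0)" using fn[OF ab(1)] inj[OF ab] by simp
    finally show "(S * mat_diag n d * T) $$ (a,b) = 1\<^sub>m k $$ (a,b)" using ab by simp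
  qed (use c in auto)
  then have "k \<le> vec_space.rank n (mat_diag n d)"
    using rank_mult_mid_le[OF c(1) mat_diag_dim c(2)] rank_one_mat by metis
  moreover have "R * S = mat_diag n d"
  proof (rule eq_matI)
    fix i j assume "i < dim_row (mat_diag n d)" "j < dim_col (mat_diag n d)"
    then have ij: "i < n" "j < n" by (auto simp: mat_diag_def)
    have "(R * S) $$ (i,j) = (\<Sum>a<k. if i = f a \<and> j = f a then d i else 0)"
      using ij c by (subst mult_mat_index_sum[of _ n k _ n]) (auto simp: S_def R_def intro!: sum.cong)
    also have "\<dots> = (if i = j then d j else 0)"
    proof (cases "i = j \<and> d i \<noteq> 0")
      case True
      then obtain a where a: "a < k" "i = f a" using surj ij by blast
      have "(\<Sum>b<k. if i = f b \<and> j = f b then d i else 0) = (\<Sum>b<k. if b = a then d i else 0)"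
        using a True inj by (intro sum.cong) auto
      then show ?thesis using a True by simp
    next
      case False
      then show ?thesis by (intro trans[OF sum.neutral]) auto
    qed
    finally show "(R * S) $$ (i,j) = mat_diag n d $$ (i,j)" using ij by (simp add: mat_diag_def)
  qed (use c in \<open>auto simp: mat_diag_def\<close>)
  then have "vec_space.rank n (mat_diag n d) \<le> k"
    using vec_space.rank_mult_le_inner_dim[OF c(3,1)] by metis
  ultimately show ?thesis by (simp add: k_def)
qed

lemma rank_unitary_conjugate:
  assumes U: "unitary_mat n U"
  shows "vec_space.rank n (U * mat_diag n d * mat_adjoint U) = card {i. i < n \<and> d i \<noteq> 0}"
proof -
  note Uc = unitary_matD(1)[OF U]
  let ?A = "U * mat_diag n d * mat_adjoint U"
  have A: "?A \<in> carrier_mat n n" using Uc by simp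
  have "vec_space.rank n ?A \<le> vec_space.rank n (mat_diag n d)"
    using Uc by (intro rank_mult_mid_le[of _ n n _ n _ n]) auto
  moreover have "vec_space.rank n (mat_diag n d) \<le> vec_space.rank n ?A"
    using rank_mult_mid_le[OF mat_adjoint_carrier[OF Uc] A Uc] diag_of_unitary_form(1)[OF U refl] by simp
  ultimately show ?thesis by (simp add: rank_mat_diag)
qed

section \<open>Shannon entropy\<close>

lemma zero_le_neg_mult_log:
  assumes "0 \<le> x" "x \<le> (1::real)"
  shows "0 \<le> (if x \<le> 0 then 0 else - x * log 2 x)"
    "(if x \<le> 0 then 0 else - x * log 2 x) = 0 \<longleftrightarrow> x = 0 \<or> x = 1"
proof -
  have "x * log 2 x \<le> 0" if "0 < x" using that assms by (simp add: mult_nonneg_nonpos)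
  then show "0 \<le> (if x \<le> 0 then 0 else - x * log 2 x)" by simp
  have "log 2 x = 0 \<longleftrightarrow> x = 1" if "0 < x" using that by (simp add: log_def)
  then show "(if x \<le> 0 then 0 else - x * log 2 x) = 0 \<longleftrightarrow> x = 0 \<or> x = 1"
    using assms by auto
qed

text \<open>Everything about the upper bound follows from one exact identity, H ln 2 = ln k - sum of
  \<open>g i\<close> over \<open>I\<close>, where k is the size of the support. Each
  \<open>g i\<close> is nonnegative and vanishes only at d i = 1 / k. The sum of the
  \<open>g i\<close> is the relative entropy of \<open>d\<close> with respect to the uniform
  distribution on \<open>I\<close>: the terms 1 / k - d i add up to 0 and serve only to make every
  single summand nonnegative.\<close>

lemma shannon_entropy_bounds:
  fixes d :: "nat \<Rightarrow> real" and m :: nat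
  defines "H \<equiv> (\<Sum>i<m. if d i \<le> 0 then 0 else - d i * log 2 (d i))"
    and "I \<equiv> {i. i < m \<and> d i \<noteq> 0}"
  assumes nonneg: "\<And>i. i < m \<Longrightarrow> 0 \<le> d i" and sum1: "(\<Sum>i<m. d i) = 1"
  shows "0 \<le> H" "H \<le> log 2 (card I)" "H = 0 \<longleftrightarrow> (\<forall>i<m. d i = 0 \<or> d i = 1)"
    "H = log 2 (card I) \<longleftrightarrow> (\<forall>i\<in>I. \<forall>j\<in>I. d i = d j)" "0 < card I"
proof -
  have le1: "d i \<le> 1" if "i < m" for i
    unfolding sum1[symmetric] by (rule member_le_sum) (use nonneg that in auto)
  have term0: "0 \<le> (if d i \<le> 0 then 0 else - d i * log 2 (d i))" if "i \<in> {..<m}" for i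
    by (rule zero_le_neg_mult_log(1)) (use nonneg le1 that in auto)
  show "0 \<le> H" unfolding H_def by (rule sum_nonneg[OF term0])
  have "H = 0 \<longleftrightarrow> (\<forall>i\<in>{..<m}. (if d i \<le> 0 then 0 else - d i * log 2 (d i)) = 0)"
    unfolding H_def by (rule sum_nonneg_eq_0_iff[OF finite_lessThan term0])
  also have "\<dots> \<longleftrightarrow> (\<forall>i\<in>{..<m}. d i = 0 \<or> d i = 1)"
    using nonneg le1 by (intro ball_cong refl zero_le_neg_mult_log(2)) auto
  finally show "H = 0 \<longleftrightarrow> (\<forall>i<m. d i = 0 \<or> d i = 1)" by auto
  have I: "finite I" "I \<subseteq> {..<m}" by (auto simp: I_def)
  have pos: "0 < d i" if "i \<in> I" for i using that nonneg[of i] by (auto simp: I_def less_le)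
  have sumI: "(\<Sum>i\<in>I. d i) = 1"
    unfolding sum1[symmetric] by (rule sum.mono_neutral_left) (auto simp: I_def)
  then have "I \<noteq> {}" by auto
  then show k: "0 < card I" using I by (simp add: card_gt_0_iff)
  define k where "k = real (card I)"
  have k0: "0 < k" using k by (simp add: k_def)
  define g where "g i = 1 / k - d i - d i * ln (1 / (k * d i))" for i
  \<comment> \<open>\<open>g i\<close> is the gap in \<open>ln y \<le> y - 1\<close> at \<open>y = 1 / (k d i)\<close>, weighted by \<open>d i\<close>.\<close>
  have g_eq: "g i = d i * (1 / (k * d i) - 1 - ln (1 / (k * d i)))" if "i \<in> I" for i
  proof -
    have "d i * (1 / (k * d i)) = 1 / k" using pos[OF that] by simp
    then show ?thesis by (simp only: g_def right_diff_distrib mult_1_right)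
  qed
  have g0: "0 \<le> g i" if "i \<in> I" for i
    unfolding g_eq[OF that] using pos[OF that] k0 ln_le_minus_one[of "1 / (k * d i)"]
    by (intro mult_nonneg_nonneg) auto
  have g_eq_0: "g i = 0 \<longleftrightarrow> d i = 1 / k" if "i \<in> I" for i
  proof
    assume "g i = 0"
    then have "ln (1 / (k * d i)) = 1 / (k * d i) - 1" using g_eq[OF that] pos[OF that] by simp
    then have "1 / (k * d i) = 1"
      by (rule ln_eq_minus_one[rotated]) (use pos[OF that] k0 in simp)
    then show "d i = 1 / k" using pos[OF that] k0 by (simp add: divide_eq_eq eq_divide_eq mult.commute)
  next
    assume "d i = 1 / k"
    then show "g i = 0" using k0 by (simp add: g_def)
  qed
  have "H = (\<Sum>i\<in>I. - d i * log 2 (d i))"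
    unfolding H_def
  proof (rule sum.mono_neutral_cong_right)
    show "\<forall>i\<in>{..<m} - I. (if d i \<le> 0 then 0 else - d i * log 2 (d i)) = 0"
      by (auto simp: I_def)
    show "(if d i \<le> 0 then 0 else - d i * log 2 (d i)) = - d i * log 2 (d i)" if "i \<in> I" for i
      using pos[OF that] by simp
  qed (use I in auto)
  then have "H * ln 2 = (\<Sum>i\<in>I. - d i * ln (d i))"
    by (simp add: sum_distrib_right log_def)
  also have "\<dots> = (\<Sum>i\<in>I. 1 / k - d i + d i * ln k - g i)"
  proof (rule sum.cong[OF refl])
    fix i assume i: "i \<in> I"
    have "ln (1 / (k * d i)) = - (ln k + ln (d i))"
      using pos[OF i] k0 by (simp add: ln_div ln_mult)
    then have "d i * ln (1 / (k * d i)) = - (d i * ln k) - d i * ln (d i)"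
      by (simp add: right_diff_distrib distrib_left)
    then show "- d i * ln (d i) = 1 / k - d i + d i * ln k - g i" by (simp add: g_def)
  qed
  also have "\<dots> = (\<Sum>i\<in>I. 1 / k) - 1 + ln k - (\<Sum>i\<in>I. g i)"
  proof -
    have "(\<Sum>i\<in>I. d i * ln k) = ln k" using sum_distrib_right[of d I "ln k"] sumI by simp
    then show ?thesis using sumI by (simp only: sum.distrib sum_subtractf)
  qed
  also have "\<dots> = ln k - (\<Sum>i\<in>I. g i)" using k0 by (simp add: k_def)
  finally have main: "H * ln 2 = ln k - (\<Sum>i\<in>I. g i)" .
  have "H = H * ln 2 / ln 2" by simp
  then have H: "H = log 2 k - (\<Sum>i\<in>I. g i) / ln 2"
    unfolding main by (simp only: log_def diff_divide_distrib)
  show "H \<le> log 2 (card I)" using H g0 by (simp add: k_def sum_nonneg)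
  have "H = log 2 (card I) \<longleftrightarrow> (\<Sum>i\<in>I. g i) = 0" using H by (simp add: k_def)
  also have "\<dots> \<longleftrightarrow> (\<forall>i\<in>I. g i = 0)" using I g0 by (intro sum_nonneg_eq_0_iff) auto
  also have "\<dots> \<longleftrightarrow> (\<forall>i\<in>I. d i = 1 / k)" using g_eq_0 by auto
  \<comment> \<open>If all entries on the support agree, normalisation forces the common value to be
    1 / k.\<close>
  also have "\<dots> \<longleftrightarrow> (\<forall>i\<in>I. \<forall>j\<in>I. d i = d j)"
  proof
    assume eq: "\<forall>i\<in>I. \<forall>j\<in>I. d i = d j"
    show "\<forall>i\<in>I. d i = 1 / k"
    proof
      fix i assume i: "i \<in> I"
      have "(\<Sum>j\<in>I. d j) = (\<Sum>j\<in>I. d i)" using eq i by (intro sum.cong refl) blast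
      then have "k * d i = 1" using sumI by (simp add: k_def)
      then show "d i = 1 / k" using k0 by (simp add: eq_divide_eq mult.commute)
    qed
  qed auto
  finally show "H = log 2 (card I) \<longleftrightarrow> (\<forall>i\<in>I. \<forall>j\<in>I. d i = d j)" .
qed

section \<open>Error correcting codes\<close>

lemma proots_linear_factors: "proots (\<Prod>e\<leftarrow>es. [:- e, 1:]) = mset (es :: complex list)"
proof (induction es)
  case (Cons e es)
  have "(\<Prod>e\<leftarrow>es. [:- e, 1:]) \<noteq> (0 :: complex poly)" by auto
  then have "proots ([:- e, 1:] * (\<Prod>e\<leftarrow>es. [:- e, 1:])) = add_mset e (mset es)"
    using Cons.IH by (subst proots_mult) auto
  then show ?case by (simp only: list.map prod_list.Cons mset.simps)
qed simp

section \<open>Kraus operators and the Choi matrix\<close>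

lemma kraus_map_eq_mat_sum: "kraus_map N m Es \<rho> = mat_sum N m (\<lambda>i. Es i * \<rho> * mat_adjoint (Es i))"
  by (simp add: kraus_map_def mat_sum_def)

text \<open>Column i stacks the columns of \<open>Es i\<close>: row a N + c holds the entry (c, a),
  with input index a and output index c. This is the index convention of
  \<open>choi_matrix\<close>.\<close>

definition kraus_matrix :: "nat \<Rightarrow> nat \<Rightarrow> (nat \<Rightarrow> complex mat) \<Rightarrow> complex mat" where
  "kraus_matrix N m Es = mat (N * N) m (\<lambda>(r,i). Es i $$ (r mod N, r div N))"

lemma kraus_matrix_carrier [simp]: "kraus_matrix N m Es \<in> carrier_mat (N * N) m"
  by (simp add: kraus_matrix_def)

lemma sandwich_matrix_unit_index:
  assumes A: "A \<in> carrier_mat N N" and B: "B \<in> carrier_mat N N"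
    and "a < N" "b < N" "c < N" "d < N"
  shows "(A * matrix_unit N a b * B) $$ (c,d) = A $$ (c,a) * (B $$ (b,d) :: complex)"
proof -
  have M: "matrix_unit N a b \<in> carrier_mat N N" by (simp add: matrix_unit_def)
  have left: "(A * matrix_unit N a b) $$ (c,t) = (if t = b then A $$ (c,a) else 0)" if "t < N" for t
  proof -
    have "(A * matrix_unit N a b) $$ (c,t) = (\<Sum>s<N. A $$ (c,s) * matrix_unit N a b $$ (s,t))"
      using assms that M by (intro mult_mat_index_sum[of _ N N _ N]) auto
    also have "\<dots> = (\<Sum>s<N. if s = a then if t = b then A $$ (c,a) else 0 else 0)"
      using that by (intro sum.cong) (auto simp: matrix_unit_def)
    also have "\<dots> = (if t = b then A $$ (c,a) else 0)" using assms by simp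
    finally show ?thesis .
  qed
  have "(A * matrix_unit N a b * B) $$ (c,d) = (\<Sum>t<N. (A * matrix_unit N a b) $$ (c,t) * B $$ (t,d))"
    using assms M by (intro mult_mat_index_sum[of _ N N _ N]) auto
  also have "\<dots> = (\<Sum>t<N. if t = b then A $$ (c,a) * B $$ (b,d) else 0)"
    by (intro sum.cong refl) (simp add: left)
  also have "\<dots> = A $$ (c,a) * B $$ (b,d)" using assms by simp
  finally show ?thesis .
qed

text \<open>The entry (c, d) of the image of |a><b| is the sum over i of E_i(c, a) times the
  conjugate of E_i(d, b), and these numbers stand in rows a N + c and b N + d of the Kraus
  matrix.\<close>

lemma choi_matrix_kraus_map:
  assumes Es: "\<And>i. i < m \<Longrightarrow> Es i \<in> carrier_mat N N"
  shows "choi_matrix N (kraus_map N m Es) = kraus_matrix N m Es * mat_adjoint (kraus_matrix N m Es)"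
proof (rule eq_matI)
  fix r s assume "r < dim_row (kraus_matrix N m Es * mat_adjoint (kraus_matrix N m Es))"
    "s < dim_col (kraus_matrix N m Es * mat_adjoint (kraus_matrix N m Es))"
  then have rs: "r < N * N" "s < N * N" by (auto simp: kraus_matrix_def)
  then have b: "r div N < N" "s div N < N" "r mod N < N" "s mod N < N"
    by (auto simp: less_mult_imp_div_less intro!: mod_less_divisor gr0I)
  have "choi_matrix N (kraus_map N m Es) $$ (r,s)
      = (\<Sum>i<m. (Es i * matrix_unit N (r div N) (s div N) * mat_adjoint (Es i)) $$ (r mod N, s mod N))"
    using rs b by (simp add: choi_matrix_def kraus_map_def)
  also have "\<dots> = (\<Sum>i<m. Es i $$ (r mod N, r div N) * cnj (Es i $$ (s mod N, s div N)))"
  proof (rule sum.cong[OF refl])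
    fix i assume "i \<in> {..<m}"
    then have E: "Es i \<in> carrier_mat N N" using Es by auto
    show "(Es i * matrix_unit N (r div N) (s div N) * mat_adjoint (Es i)) $$ (r mod N, s mod N)
      = Es i $$ (r mod N, r div N) * cnj (Es i $$ (s mod N, s div N))"
      using sandwich_matrix_unit_index[OF E mat_adjoint_carrier[OF E] b] E b by simp
  qed
  also have "\<dots> = (kraus_matrix N m Es * mat_adjoint (kraus_matrix N m Es)) $$ (r,s)"
    using rs by (subst mult_mat_index_sum[of _ "N * N" m _ "N * N"])
      (auto simp: kraus_matrix_def intro!: sum.cong)
  finally show "choi_matrix N (kraus_map N m Es) $$ (r,s)
      = (kraus_matrix N m Es * mat_adjoint (kraus_matrix N m Es)) $$ (r,s)" .
qed (auto simp: choi_matrix_def kraus_matrix_def)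

text \<open>Each block of \<open>N\<close> consecutive indices contains exactly one index with
  residue \<open>c\<close>. This evaluates a contraction over the input index of a vectorised
  operator while the output index \<open>c\<close> is held fixed.\<close>

lemma sum_over_residue:
  fixes f :: "nat \<Rightarrow> 'a :: comm_monoid_add"
  assumes "c < N"
  shows "(\<Sum>r<n * N. if r mod N = c then f (r div N) else 0) = (\<Sum>a<n. f a)"
proof -
  have "(\<Sum>r<n * N. if r mod N = c then f (r div N) else 0)
      = (\<Sum>a<n. \<Sum>r=a * N..<a * N + N. if r mod N = c then f (r div N) else 0)"
    by (rule sum.nat_group[symmetric])
  also have "\<dots> = (\<Sum>a<n. \<Sum>r=a * N..<a * N + N. if r = a * N + c then f a else 0)"
  proof (intro sum.cong refl)
    fix a r assume "r \<in> {a * N..<a * N + N}"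
    then obtain q where q: "r = a * N + q" "q < N"
      by (metis add_less_cancel_left atLeastLessThan_iff le_Suc_ex)
    then show "(if r mod N = c then f (r div N) else 0) = (if r = a * N + c then f a else 0)"
      by simp
  qed
  also have "\<dots> = (\<Sum>a<n. f a)" using assms by (intro sum.cong) auto
  finally show ?thesis .
qed

section \<open>Codes and their matrix as a Gram matrix\<close>

locale qec_code =
  fixes N m :: nat and Es :: "nat \<Rightarrow> complex mat" and P :: "complex mat"
    and lam :: "nat \<Rightarrow> nat \<Rightarrow> complex"
  assumes kraus: "kraus_family N m Es"
    and proj: "orth_projection N P" and nonzero: "P \<noteq> 0\<^sub>m N N"
    and code: "\<forall>i<m. \<forall>j<m. P * mat_adjoint (Es i) * Es j * P = lam i j \<cdot>\<^sub>m P"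
begin

definition Lam :: "complex mat" where "Lam = mat m m (\<lambda>(i,j). lam i j)"

definition F :: "nat \<Rightarrow> complex mat" where "F i = Es i * P"

lemma Lam_carrier [simp]: "Lam \<in> carrier_mat m m"
  by (simp add: Lam_def)

lemma Es_carrier: "i < m \<Longrightarrow> Es i \<in> carrier_mat N N"
  using kraus by (simp add: kraus_family_def)

lemma P: "P \<in> carrier_mat N N" "P * P = P" "mat_adjoint P = P"
  using proj by (auto simp: orth_projection_def)

lemma F_carrier: "i < m \<Longrightarrow> F i \<in> carrier_mat N N"
  using Es_carrier P by (simp add: F_def)

lemma adjoint_F_mult_F:
  assumes "i < m" "j < m"
  shows "mat_adjoint (F i) * F j = lam i j \<cdot>\<^sub>m P"
proof -
  have "mat_adjoint (F i) * F j = P * mat_adjoint (Es i) * Es j * P"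
    using Es_carrier[OF assms(1)] Es_carrier[OF assms(2)] P
    by (simp add: F_def mat_adjoint_mult[of _ N N _ N] assoc_mult_mat[of _ N N _ N _ N])
  then show ?thesis using code assms by simp
qed

lemma kraus_map_code:
  assumes \<rho>: "\<rho> \<in> carrier_mat N N"
  shows "kraus_map N m Es (P * \<rho> * P) = mat_sum N m (\<lambda>i. F i * \<rho> * mat_adjoint (F i))"
  unfolding kraus_map_eq_mat_sum
proof (rule mat_sum_cong)
  fix i assume "i < m"
  then show "Es i * (P * \<rho> * P) * mat_adjoint (Es i) = F i * \<rho> * mat_adjoint (F i)"
    using Es_carrier P \<rho>
    by (simp add: F_def mat_adjoint_mult[of _ N N _ N] assoc_mult_mat[of _ N N _ N _ N])
qed

text \<open>As P = P^* P, the diagonal entry at c is the squared norm of column c, so if no diagonal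
  entry were positive, all columns would vanish.\<close>

lemma exists_positive_diagonal_entry:
  "\<exists>p<N. \<exists>q>0. P $$ (p,p) = complex_of_real q"
proof (rule ccontr)
  assume none: "\<not> ?thesis"
  have "P = 0\<^sub>m N N"
  proof (rule eq_matI)
    fix r c assume "r < dim_row (0\<^sub>m N N)" "c < dim_col (0\<^sub>m N N)"
    then have rc: "r < N" "c < N" by auto
    let ?q = "\<Sum>r<N. (cmod (P $$ (r,c)))\<^sup>2"
    have "P $$ (c,c) = complex_of_real ?q"
      using adjoint_mult_self_diag[OF P(1) rc(2)] by (simp only: P)
    then have "\<not> ?q > 0" using none rc by blast
    then have "?q = 0" by (simp add: sum_nonneg order_less_le)
    then have "\<forall>r\<in>{..<N}. (cmod (P $$ (r,c)))\<^sup>2 = 0"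
      by (subst (asm) sum_nonneg_eq_0_iff) auto
    then show "P $$ (r,c) = 0\<^sub>m N N $$ (r,c)" using rc by simp
  qed (use P in auto)
  then show False using nonzero by simp
qed

text \<open>Here the code being nonzero enters: identities between multiples of \<open>P\<close> may
  be read as identities between the scalars.\<close>

lemma smult_P_inject: "a \<cdot>\<^sub>m P = b \<cdot>\<^sub>m P \<Longrightarrow> a = b"
proof -
  assume eq: "a \<cdot>\<^sub>m P = b \<cdot>\<^sub>m P"
  obtain p q where p: "p < N" "q > 0" "P $$ (p,p) = complex_of_real q"
    using exists_positive_diagonal_entry by blast
  then show "a = b" using arg_cong[OF eq, of "\<lambda>M. M $$ (p,p)"] P(1) by simp
qed

text \<open>Trace preservation, the relation sum of E_i^* E_i = 1, is sandwiched between two copies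
  of \<open>P\<close>.\<close>

lemma sum_lam_diag: "(\<Sum>i<m. lam i i) = 1"
proof -
  have "(\<Sum>i<m. lam i i) \<cdot>\<^sub>m P = mat_sum N m (\<lambda>i. lam i i \<cdot>\<^sub>m P)"
    by (rule mat_sum_smult[OF P(1), symmetric])
  also have "\<dots> = mat_sum N m (\<lambda>i. P * (mat_adjoint (Es i) * Es i) * P)"
    using code Es_carrier P by (intro mat_sum_cong) (simp add: assoc_mult_mat[of _ N N _ N _ N])
  also have "\<dots> = mat_sum N m (\<lambda>i. P * (mat_adjoint (Es i) * Es i)) * P"
    using Es_carrier P by (intro mat_sum_mult[symmetric]) auto
  also have "mat_sum N m (\<lambda>i. P * (mat_adjoint (Es i) * Es i))
      = P * mat_sum N m (\<lambda>i. mat_adjoint (Es i) * Es i)"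
    using Es_carrier P by (intro mult_mat_sum[symmetric]) auto
  also have "mat_sum N m (\<lambda>i. mat_adjoint (Es i) * Es i) = 1\<^sub>m N"
    using kraus by (simp add: kraus_family_def mat_sum_def)
  also have "P * 1\<^sub>m N * P = P" using P by simp
  also have "P = 1 \<cdot>\<^sub>m P" by (intro eq_matI) auto
  finally show ?thesis by (rule smult_P_inject)
qed

text \<open>Comparing one nonzero diagonal entry of \<open>P\<close> on both sides of the code condition exhibits
  \<open>Lam\<close> as a Gram matrix that factors through the Kraus matrix.\<close>

lemma Lam_gram:
  "\<exists>q>0. \<exists>L R. L \<in> carrier_mat N m \<and> R \<in> carrier_mat N (N * N) \<and> L = R * kraus_matrix N m Es \<and>
     Lam = complex_of_real (1 / q) \<cdot>\<^sub>m (mat_adjoint L * L)"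
proof -
  obtain p q where p: "p < N" "q > 0" "P $$ (p,p) = complex_of_real q"
    using exists_positive_diagonal_entry by blast
  \<comment> \<open>Column j of \<open>L\<close> is \<open>F j\<close> applied to the p-th basis
    vector, so L^* L has the entries of F_i^* F_j at (p, p), namely \<open>lam i j\<close> times
    \<open>q\<close>. As F_j = E_j P, this vector depends linearly on the vectorised E_j, and
    \<open>R\<close> is the matrix of that linear map: it contracts the input index with column p of
    \<open>P\<close>.\<close>
  define L where "L = mat N m (\<lambda>(c,j). F j $$ (c,p))"
  define R where "R = mat N (N * N) (\<lambda>(c,r). if r mod N = c then P $$ (r div N, p) else 0)"
  have L: "L \<in> carrier_mat N m" and R: "R \<in> carrier_mat N (N * N)" by (auto simp: L_def R_def)
  have "L = R * kraus_matrix N m Es"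
  proof (rule eq_matI)
    fix c j assume "c < dim_row (R * kraus_matrix N m Es)" "j < dim_col (R * kraus_matrix N m Es)"
    then have cj: "c < N" "j < m" by (auto simp: R_def kraus_matrix_def)
    have "(R * kraus_matrix N m Es) $$ (c,j)
        = (\<Sum>r<N * N. R $$ (c,r) * kraus_matrix N m Es $$ (r,j))"
      using cj R by (intro mult_mat_index_sum[of _ N "N * N" _ m]) auto
    also have "\<dots> = (\<Sum>r<N * N. if r mod N = c then Es j $$ (c, r div N) * P $$ (r div N, p) else 0)"
      using cj by (intro sum.cong) (auto simp: R_def kraus_matrix_def)
    also have "\<dots> = (\<Sum>a<N. Es j $$ (c,a) * P $$ (a,p))" by (rule sum_over_residue[OF cj(1)])
    also have "\<dots> = F j $$ (c,p)"
      unfolding F_def using cj p Es_carrier[OF cj(2)] P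
      by (intro mult_mat_index_sum[symmetric, of _ N N _ N]) auto
    finally show "L $$ (c,j) = (R * kraus_matrix N m Es) $$ (c,j)" using cj by (simp add: L_def)
  qed (auto simp: L_def R_def kraus_matrix_def)
  moreover have "Lam = complex_of_real (1 / q) \<cdot>\<^sub>m (mat_adjoint L * L)"
  proof (rule eq_matI)
    fix i j assume "i < dim_row (complex_of_real (1 / q) \<cdot>\<^sub>m (mat_adjoint L * L))"
      "j < dim_col (complex_of_real (1 / q) \<cdot>\<^sub>m (mat_adjoint L * L))"
    then have ij: "i < m" "j < m" using L by auto
    have "(mat_adjoint L * L) $$ (i,j) = (\<Sum>c<N. cnj (F i $$ (c,p)) * F j $$ (c,p))"
      unfolding adjoint_mult_self_index[OF L ij] using ij p by (intro sum.cong) (auto simp: L_def)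
    also have "\<dots> = (mat_adjoint (F i) * F j) $$ (p,p)"
      using F_carrier[OF ij(1)] F_carrier[OF ij(2)] p
      by (subst mult_mat_index_sum[of _ N N _ N]) (auto intro!: sum.cong)
    also have "\<dots> = lam i j * of_real q"
      using adjoint_F_mult_F[OF ij] p P by simp
    finally have "(mat_adjoint L * L) $$ (i,j) = lam i j * of_real q" .
    moreover have "(complex_of_real (1 / q) \<cdot>\<^sub>m (mat_adjoint L * L)) $$ (i,j)
        = complex_of_real (1 / q) * (mat_adjoint L * L) $$ (i,j)"
      using ij L by (intro index_smult_mat) auto
    ultimately show "Lam $$ (i,j) = (complex_of_real (1 / q) \<cdot>\<^sub>m (mat_adjoint L * L)) $$ (i,j)"
      using ij p(2) by (simp add: Lam_def del: index_mult_mat)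
  qed (use L in \<open>auto simp: Lam_def\<close>)
  ultimately show ?thesis using p(2) L R by blast
qed

section \<open>Spectrum and rank of the code matrix\<close>

lemma Lam_hermitian: "mat_adjoint Lam = Lam"
proof -
  obtain q L where "L \<in> carrier_mat N m" "Lam = complex_of_real (1 / q) \<cdot>\<^sub>m (mat_adjoint L * L)"
    using Lam_gram by blast
  then show ?thesis by (simp add: mat_adjoint_smult mat_adjoint_mult[of _ m N _ m])
qed

text \<open>A single indexed family \<open>d\<close> serves the entropy, the trace, the eigenvalues
  and, through the diagonal form, the rank, so the rest of the argument is about a probability
  vector.\<close>

lemma Lam_diagonalization:
  "\<exists>d U. unitary_mat m U \<and> Lam = U * mat_diag m (\<lambda>i. complex_of_real (d i)) * mat_adjoint U \<and>
     (\<forall>i<m. 0 \<le> d i) \<and> (\<Sum>i<m. d i) = 1 \<and>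
     entropy Lam = (\<Sum>i<m. if d i \<le> 0 then 0 else - d i * log 2 (d i)) \<and>
     (\<forall>a. eigenvalue Lam a \<longleftrightarrow> (\<exists>i<m. a = complex_of_real (d i)))"
proof -
  obtain es where es: "char_poly Lam = (\<Prod>e\<leftarrow>es. [:- e, 1:])" "length es = m"
    using char_poly_factorized[OF Lam_carrier] by blast
  obtain U where U: "unitary_mat m U" and LU: "Lam = U * mat_diag m ((!) es) * mat_adjoint U"
    using hermitian_unitary_diagonalization[OF Lam_carrier Lam_hermitian es(1)] by blast
  note Uc = unitary_matD(1)[OF U] and diag = diag_of_unitary_form[OF U LU]
  obtain q L where q: "q > 0" and L: "L \<in> carrier_mat N m"
    and LL: "Lam = complex_of_real (1 / q) \<cdot>\<^sub>m (mat_adjoint L * L)"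
    using Lam_gram by blast
  define d where "d i = Re (es ! i)" for i
  \<comment> \<open>Positivity from the Gram form: the i-th diagonal entry of U^* Lam U is 1 / q
    times the squared norm of column i of \<open>L * U\<close>.\<close>
  have es_d: "es ! i = complex_of_real (d i) \<and> 0 \<le> d i" if i: "i < m" for i
  proof -
    have LUc: "L * U \<in> carrier_mat N m" using L Uc by simp
    have "es ! i = (mat_adjoint U * Lam * U) $$ (i,i)" using i by (simp add: diag(1) mat_diag_def)
    also have "mat_adjoint U * Lam * U = complex_of_real (1 / q) \<cdot>\<^sub>m (mat_adjoint (L * U) * (L * U))"
    proof -
      have "mat_adjoint U * (mat_adjoint L * L) * U = mat_adjoint (L * U) * (L * U)"
      proof -
        have "mat_adjoint U * (mat_adjoint L * L) * U = (mat_adjoint U * mat_adjoint L) * L * U"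
          using Uc L by (subst assoc_mult_mat[of _ m m _ N _ m]) auto
        also have "\<dots> = (mat_adjoint U * mat_adjoint L) * (L * U)"
          using Uc L by (intro assoc_mult_mat[of _ m N _ m _ m]) auto
        finally show ?thesis using Uc L by (simp add: mat_adjoint_mult[of _ N m _ m])
      qed
      moreover have "mat_adjoint L * L \<in> carrier_mat m m" using L by (intro mult_carrier_mat[of _ m N]) auto
      ultimately show ?thesis
        unfolding LL using Uc by (simp add: mult_smult_distrib[of _ m m _ m] mult_smult_assoc_mat[of _ m m _ m])
    qed
    also have "(complex_of_real (1 / q) \<cdot>\<^sub>m (mat_adjoint (L * U) * (L * U))) $$ (i,i)
        = complex_of_real (1 / q) * (mat_adjoint (L * U) * (L * U)) $$ (i,i)"
      using i LUc by (intro index_smult_mat) auto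
    also have "\<dots> = complex_of_real (1 / q * (\<Sum>r<N. (cmod ((L * U) $$ (r,i)))\<^sup>2))"
      unfolding adjoint_mult_self_diag[OF LUc i] of_real_mult ..
    finally have eq: "es ! i = complex_of_real (1 / q * (\<Sum>r<N. (cmod ((L * U) $$ (r,i)))\<^sup>2))" .
    moreover have "0 \<le> 1 / q * (\<Sum>r<N. (cmod ((L * U) $$ (r,i)))\<^sup>2)"
      using q by (intro mult_nonneg_nonneg sum_nonneg) auto
    ultimately show ?thesis unfolding d_def by (simp only: Re_complex_of_real)
  qed
  have D: "mat_diag m ((!) es) = mat_diag m (\<lambda>i. complex_of_real (d i))"
    unfolding mat_diag_def using es_d by (intro cong_mat) auto
  have "mat_trace Lam = (\<Sum>i<m. lam i i)" by (simp add: mat_trace_def Lam_def)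
  then have "(\<Sum>i<m. es ! i) = 1" using diag(2) sum_lam_diag by simp
  then have "complex_of_real (\<Sum>i<m. d i) = 1" using es_d by simp
  then have sum1: "(\<Sum>i<m. d i) = 1" by (simp only: of_real_eq_1_iff)
  have mset: "eigenvalues_mset Lam = mset es"
    by (simp add: eigenvalues_mset_def es(1) proots_linear_factors)
  have "entropy Lam = (\<Sum>x\<leftarrow>es. if Re x \<le> 0 then 0 else - Re x * log 2 (Re x))"
    by (simp add: entropy_def mset flip: sum_mset_sum_list)
  also have "\<dots> = (\<Sum>i<m. if d i \<le> 0 then 0 else - d i * log 2 (d i))"
    unfolding d_def by (simp add: sum_list_sum_nth es(2) lessThan_atLeast0)
  finally have ent: "entropy Lam = (\<Sum>i<m. if d i \<le> 0 then 0 else - d i * log 2 (d i))" .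
  have "eigenvalue Lam a \<longleftrightarrow> (\<exists>i<m. a = complex_of_real (d i))" for a
  proof -
    have "eigenvalue Lam a \<longleftrightarrow> a \<in> set es"
      unfolding eigenvalue_root_char_poly[OF Lam_carrier] es(1) poly_prod_list by auto
    then show ?thesis using es_d es(2) by (auto simp: in_set_conv_nth)
  qed
  then show ?thesis using U LU[unfolded D] es_d sum1 ent by blast
qed

lemma rank_Lam_le_choi_rank: "vec_space.rank m Lam \<le> choi_rank N (kraus_map N m Es)"
proof -
  let ?K = "kraus_matrix N m Es"
  obtain q L R where L: "L \<in> carrier_mat N m" and R: "R \<in> carrier_mat N (N * N)"
    and LR: "L = R * ?K" and LL: "Lam = complex_of_real (1 / q) \<cdot>\<^sub>m (mat_adjoint L * L)"
    using Lam_gram by blast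
  define X where "X = complex_of_real (1 / q) \<cdot>\<^sub>m (mat_adjoint L * R)"
  have LRc: "mat_adjoint L * R \<in> carrier_mat m (N * N)"
    by (rule mult_carrier_mat[OF mat_adjoint_carrier[OF L] R])
  then have X: "X \<in> carrier_mat m (N * N)" by (simp add: X_def)
  have K: "?K \<in> carrier_mat (N * N) m" by simp
  have "mat_adjoint L * L = mat_adjoint L * R * ?K"
    using assoc_mult_mat[OF mat_adjoint_carrier[OF L] R K] by (simp only: LR[symmetric])
  then have 1: "Lam = X * ?K"
    unfolding LL X_def by (simp only: mult_smult_assoc_mat[OF LRc K])
  \<comment> \<open>Taking adjoints of the first form moves K^* to the left, where it meets the
    \<open>?K\<close> of the other factor in \<open>Lam * Lam\<close>.\<close>
  have 2: "Lam = mat_adjoint ?K * mat_adjoint X"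
    using Lam_hermitian mat_adjoint_mult[OF X K] by (simp only: 1[symmetric])
  have Ka: "mat_adjoint ?K \<in> carrier_mat m (N * N)" and Xa: "mat_adjoint X \<in> carrier_mat (N * N) m"
    using K X by auto
  have "Lam * Lam = (X * ?K) * (mat_adjoint ?K * mat_adjoint X)" using 1 2 by simp
  also have "\<dots> = X * (?K * (mat_adjoint ?K * mat_adjoint X))" by (rule assoc_mult_mat[OF X K mult_carrier_mat[OF Ka Xa]])
  also have "?K * (mat_adjoint ?K * mat_adjoint X) = ?K * mat_adjoint ?K * mat_adjoint X"
    by (rule assoc_mult_mat[OF K Ka Xa, symmetric])
  also have "X * (?K * mat_adjoint ?K * mat_adjoint X) = X * (?K * mat_adjoint ?K) * mat_adjoint X"
    by (rule assoc_mult_mat[OF X mult_carrier_mat[OF K Ka] Xa, symmetric])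
  finally have "vec_space.rank m (Lam * Lam) \<le> vec_space.rank (N * N) (?K * mat_adjoint ?K)"
    using rank_mult_mid_le[OF X mult_carrier_mat[OF K Ka] Xa] by (simp only:)
  also have "\<dots> = choi_rank N (kraus_map N m Es)"
    using choi_matrix_kraus_map[of m Es N] Es_carrier by (simp add: choi_rank_def)
  finally have le: "vec_space.rank m (Lam * Lam) \<le> choi_rank N (kraus_map N m Es)" .
  obtain U d where U: "unitary_mat m U"
    and D: "Lam = U * mat_diag m (\<lambda>i. complex_of_real (d i)) * mat_adjoint U"
    using Lam_diagonalization by blast
  \<comment> \<open>Both ranks count nonzero diagonal entries under the same \<open>U\<close>, and
    squaring does not change which ones vanish.\<close>
  have "vec_space.rank m (Lam * Lam) = vec_space.rank m Lam"
    unfolding diag_of_unitary_form(3)[OF U D] rank_unitary_conjugate[OF U]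
    by (subst D) (simp add: rank_unitary_conjugate[OF U])
  with le show ?thesis by simp
qed

section \<open>Entropy zero and unitary correction\<close>

lemma unitarily_correctable_if_rank_one:
  assumes u: "\<And>i j. i < m \<Longrightarrow> j < m \<Longrightarrow> lam i j = cnj (u i) * u j"
  shows "unitarily_correctable N (kraus_map N m Es) P"
proof -
  have norm: "(\<Sum>i<m. u i * cnj (u i)) = 1"
    using sum_lam_diag by (simp add: u mult.commute)
  have "\<exists>k<m. u k \<noteq> 0"
  proof (rule ccontr)
    assume "\<not> ?thesis"
    then have "(\<Sum>i<m. u i * cnj (u i)) = 0" by (intro sum.neutral) simp
    then show False using norm by simp
  qed
  then obtain k where k: "k < m" "u k \<noteq> 0" by blast
  \<comment> \<open>If all F_j are to be multiples of one operator, it can be read off from any k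
    with a nonzero coefficient. Dividing by \<open>u k\<close> normalises it, since F_k^* F_k is the
    squared modulus of \<open>u k\<close> times \<open>P\<close>.\<close>
  define W where "W = (1 / u k) \<cdot>\<^sub>m F k"
  have W: "W \<in> carrier_mat N N" using F_carrier k by (simp add: W_def)
  note smult = mult_smult_distrib[of _ N N _ N] mult_smult_assoc_mat[of _ N N _ N]
  have WF: "mat_adjoint W * F j = u j \<cdot>\<^sub>m P" if "j < m" for j
    unfolding W_def mat_adjoint_smult
    using F_carrier[OF k(1)] F_carrier[OF that] adjoint_F_mult_F[OF k(1) that] u[OF k(1) that] k(2) P(1)
    by (simp add: smult) (simp add: smult_smult_mat)
  have WW: "mat_adjoint W * W = P"
  proof -
    have "mat_adjoint W * W = (1 / u k) \<cdot>\<^sub>m (mat_adjoint W * F k)"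
      using W F_carrier[OF k(1)] by (simp add: W_def smult)
    also have "\<dots> = P" unfolding WF[OF k(1)] using k(2) by (intro eq_matI) auto
    finally show ?thesis .
  qed
  have F_eq: "F j = u j \<cdot>\<^sub>m W" if j: "j < m" for j
  proof -
    note Fj = F_carrier[OF j]
    define X where "X = F j - u j \<cdot>\<^sub>m W"
    have X: "X \<in> carrier_mat N N" unfolding X_def by (rule minus_carrier_mat) (use W in simp)
    have FW: "mat_adjoint (F j) * W = cnj (u j) \<cdot>\<^sub>m P"
      using arg_cong[OF WF[OF j], of mat_adjoint] Fj W
      by (simp add: mat_adjoint_mult[of _ N N _ N] mat_adjoint_smult P(3))
    \<comment> \<open>All four terms are multiples of \<open>P\<close> with coefficient cnj (u j) u
      j, two of each sign.\<close>
    have "mat_adjoint X * X = mat_adjoint (F j) * F j - cnj (u j) \<cdot>\<^sub>m (mat_adjoint W * F j)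
        - u j \<cdot>\<^sub>m (mat_adjoint (F j) * W - cnj (u j) \<cdot>\<^sub>m (mat_adjoint W * W))"
      unfolding X_def using Fj W
      by (simp add: mat_adjoint_minus[of _ N N] mat_adjoint_smult smult minus_carrier_mat
          minus_mult_distrib_mat[of _ N N _ _ N] mult_minus_distrib_mat[of _ N N _ N])
    also have "\<dots> = 0\<^sub>m N N"
      unfolding adjoint_F_mult_F[OF j j] FW WF[OF j] WW u[OF j j]
      using P(1) by (intro eq_matI) (auto simp: algebra_simps)
    finally have "X = 0\<^sub>m N N" by (rule adjoint_mult_self_eq_0[OF X])
    then show ?thesis using minus_mat_eq_0D[OF Fj _, of "u j \<cdot>\<^sub>m W"] W by (simp add: X_def)
  qed
  obtain V where V: "unitary_mat N V" and VP: "V * P = W"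
    using partial_isometry_extends[OF W proj WW] by blast
  note Vc = unitary_matD(1)[OF V]
  have "mat_adjoint V * kraus_map N m Es (P * \<rho> * P) * mat_adjoint (mat_adjoint V) = P * \<rho> * P"
    if \<rho>: "\<rho> \<in> carrier_mat N N" for \<rho>
  proof -
    \<comment> \<open>On the code every Kraus operator acts as \<open>W\<close> up to the factor
      \<open>u i\<close>, and the squared moduli of these factors add up to 1, so the channel is
      conjugation by \<open>W\<close>.\<close>
    have "kraus_map N m Es (P * \<rho> * P)
        = mat_sum N m (\<lambda>i. (u i * cnj (u i)) \<cdot>\<^sub>m (W * \<rho> * mat_adjoint W))"
      unfolding kraus_map_code[OF \<rho>]
    proof (rule mat_sum_cong)
      fix i assume "i < m"
      then show "F i * \<rho> * mat_adjoint (F i) = (u i * cnj (u i)) \<cdot>\<^sub>m (W * \<rho> * mat_adjoint W)"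
        using W \<rho> by (simp add: F_eq mat_adjoint_smult smult) (simp add: smult_smult_mat mult.commute)
    qed
    also have "\<dots> = 1 \<cdot>\<^sub>m (W * \<rho> * mat_adjoint W)"
      using W \<rho> by (subst mat_sum_smult) (auto simp: norm)
    also have "\<dots> = W * \<rho> * mat_adjoint W" by (intro eq_matI) auto
    also have "\<dots> = V * (P * \<rho> * P) * mat_adjoint V"
      unfolding VP[symmetric] using Vc P \<rho>
      by (simp add: mat_adjoint_mult[of _ N N _ N] assoc_mult_mat[of _ N N _ N _ N])
    finally show ?thesis
      using unitary_conjugate[OF unitary_mat_adjoint[OF V], of "P * \<rho> * P"] P \<rho> by simp
  qed
  then show ?thesis
    unfolding unitarily_correctable_def using unitary_mat_adjoint[OF V] by blast
qed

text \<open>The correction condition is applied only to the identity matrix. It yields a resolution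
  of \<open>P\<close> by the corrected operators G_i, which satisfy the same code relations as the
  F_i because \<open>U\<close> is unitary.\<close>

lemma Lam_square_idempotent_if_unitarily_correctable:
  assumes "unitarily_correctable N (kraus_map N m Es) P"
  shows "Lam * Lam * (Lam * Lam) = Lam * Lam"
proof -
  obtain U where U: "unitary_mat N U"
    and corr: "\<And>\<rho>. \<rho> \<in> carrier_mat N N \<Longrightarrow>
      U * kraus_map N m Es (P * \<rho> * P) * mat_adjoint U = P * \<rho> * P"
    using assms unfolding unitarily_correctable_def by blast
  note Uc = unitary_matD(1)[OF U]
  define G where "G i = U * F i" for i
  have G: "G i \<in> carrier_mat N N" if "i < m" for i using F_carrier[OF that] Uc by (simp add: G_def)
  note alg = assoc_mult_mat[of _ N N _ N _ N]
  have GG: "mat_adjoint (G i) * G j = lam i j \<cdot>\<^sub>m P" if "i < m" "j < m" for i j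
    using F_carrier[OF that(1)] F_carrier[OF that(2)] Uc adjoint_F_mult_F[OF that]
      unitary_mult_cancel(1)[OF U F_carrier[OF that(2)]]
    by (simp add: G_def mat_adjoint_mult[of _ N N _ N] alg)
  have sumG: "mat_sum N m (\<lambda>i. G i * mat_adjoint (G i)) = P"
  proof -
    have "P = U * kraus_map N m Es (P * 1\<^sub>m N * P) * mat_adjoint U"
      using corr[of "1\<^sub>m N"] P by simp
    also have "\<dots> = mat_sum N m (\<lambda>i. U * (F i * 1\<^sub>m N * mat_adjoint (F i)) * mat_adjoint U)"
      unfolding kraus_map_code[OF one_carrier_mat]
      using Uc F_carrier by (intro mat_sum_sandwich) auto
    also have "\<dots> = mat_sum N m (\<lambda>i. G i * mat_adjoint (G i))"
      using Uc F_carrier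
      by (intro mat_sum_cong)
        (simp add: G_def mat_adjoint_mult[of _ N N _ N] alg left_mult_one_mat[of _ N N])
    finally show ?thesis by simp
  qed
  have sandwich: "A * P * B = mat_sum N m (\<lambda>i. (A * G i) * (mat_adjoint (G i) * B))"
    if "A \<in> carrier_mat N N" "B \<in> carrier_mat N N" for A B
  proof -
    have "A * P * B = mat_sum N m (\<lambda>i. A * (G i * mat_adjoint (G i)) * B)"
      unfolding sumG[symmetric] using that G by (intro mat_sum_sandwich) auto
    also have "\<dots> = mat_sum N m (\<lambda>i. (A * G i) * (mat_adjoint (G i) * B))"
      using that G by (intro mat_sum_cong) (simp add: alg)
    finally show ?thesis .
  qed
  define M where "M = Lam * Lam"
  have Mc: "M \<in> carrier_mat m m" by (simp add: M_def)
  have prod: "(a \<cdot>\<^sub>m P) * (b \<cdot>\<^sub>m P) = (a * b) \<cdot>\<^sub>m P" for a b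
    using P(1) by (simp add: mult_smult_distrib[of _ N N _ N] mult_smult_assoc_mat[of _ N N _ N] P(2) smult_smult_mat mult.commute)
  have GPG: "mat_adjoint (G k) * P * G l = M $$ (k,l) \<cdot>\<^sub>m P" if kl: "k < m" "l < m" for k l
  proof -
    have "mat_adjoint (G k) * P * G l = mat_sum N m (\<lambda>i. (lam k i * lam i l) \<cdot>\<^sub>m P)"
      using kl G by (subst sandwich) (auto simp: GG prod intro!: mat_sum_cong)
    also have "\<dots> = (\<Sum>i<m. lam k i * lam i l) \<cdot>\<^sub>m P" by (rule mat_sum_smult[OF P(1)])
    also have "(\<Sum>i<m. lam k i * lam i l) = M $$ (k,l)"
      unfolding M_def using kl by (subst mult_mat_index_sum[of _ m m _ m]) (auto simp: Lam_def)
    finally show ?thesis .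
  qed
  have "M * M = M"
  proof (rule eq_matI)
    fix k l assume "k < dim_row M" "l < dim_col M"
    then have kl: "k < m" "l < m" using Mc by auto
    note Gk = G[OF kl(1)] and Gl = G[OF kl(2)]
    have PGl: "P * G l \<in> carrier_mat N N" and GkP: "mat_adjoint (G k) * P \<in> carrier_mat N N"
      using P(1) Gk Gl by auto
    \<comment> \<open>The projection is tripled: the middle copy is replaced by the sum over i, and
      the outer two remain so that each half is again of the form G^* P G and contributes an entry
      of \<open>M\<close>.\<close>
    have "M $$ (k,l) \<cdot>\<^sub>m P = (mat_adjoint (G k) * P) * P * (P * G l)"
      using P Gk Gl by (simp add: GPG[OF kl, symmetric] alg)
        (simp add: P(2) assoc_mult_mat[of P N N P N _ N, symmetric])
    also have "\<dots> = mat_sum N m (\<lambda>i. (mat_adjoint (G k) * P * G i) * (mat_adjoint (G i) * (P * G l)))"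
      by (rule sandwich[OF GkP PGl])
    also have "\<dots> = mat_sum N m (\<lambda>i. (M $$ (k,i) * M $$ (i,l)) \<cdot>\<^sub>m P)"
    proof (rule mat_sum_cong)
      fix i assume i: "i < m"
      have "mat_adjoint (G i) * (P * G l) = mat_adjoint (G i) * P * G l"
        using G[OF i] Gl P by (simp add: alg)
      then show "(mat_adjoint (G k) * P * G i) * (mat_adjoint (G i) * (P * G l))
          = (M $$ (k,i) * M $$ (i,l)) \<cdot>\<^sub>m P"
        by (simp only: GPG[OF kl(1) i] GPG[OF i kl(2)] prod)
    qed
    also have "\<dots> = (\<Sum>i<m. M $$ (k,i) * M $$ (i,l)) \<cdot>\<^sub>m P" by (rule mat_sum_smult[OF P(1)])
    also have "(\<Sum>i<m. M $$ (k,i) * M $$ (i,l)) = (M * M) $$ (k,l)"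
      using kl Mc by (intro mult_mat_index_sum[symmetric]) auto
    finally show "(M * M) $$ (k,l) = M $$ (k,l)" by (rule smult_P_inject[symmetric])
  qed (use Mc in auto)
  then show ?thesis by (simp add: M_def)
qed

text \<open>The upper bound is the chain entropy <= log (rank) <= log D. Equality with log D holds
  exactly if both links are equalities, and these are the two clauses of nondegeneracy: full rank
  and a flat nonzero spectrum.\<close>

lemma entropy_characterization:
  fixes D :: nat
  defines "D \<equiv> choi_rank N (kraus_map N m Es)"
  shows "(0 \<le> entropy Lam \<and> entropy Lam \<le> log 2 (real D)) \<and>
         (entropy Lam = 0 \<longleftrightarrow> unitarily_correctable N (kraus_map N m Es) P) \<and>
         (entropy Lam = log 2 (real D) \<longleftrightarrow> nondegenerate_code m Lam D)"
proof -
  obtain d U where U: "unitary_mat m U"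
    and LU: "Lam = U * mat_diag m (\<lambda>i. complex_of_real (d i)) * mat_adjoint U"
    and d0: "\<forall>i<m. 0 \<le> d i" and d1: "(\<Sum>i<m. d i) = 1"
    and ent: "entropy Lam = (\<Sum>i<m. if d i \<le> 0 then 0 else - d i * log 2 (d i))"
    and ev: "\<forall>a. eigenvalue Lam a \<longleftrightarrow> (\<exists>i<m. a = complex_of_real (d i))"
    using Lam_diagonalization by blast
  note Uc = unitary_matD(1)[OF U]
  define I where "I = {i. i < m \<and> d i \<noteq> 0}"
  note H = shannon_entropy_bounds[of m d, folded I_def ent, OF d0[rule_format] d1]
  have rank: "vec_space.rank m Lam = card I"
    by (subst LU) (simp add: rank_unitary_conjugate[OF U] I_def)
  have le: "card I \<le> D" using rank_Lam_le_choi_rank by (simp add: rank D_def)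
  \<comment> \<open>\<open>H(5)\<close> says that the support is nonempty; monotonicity and
    injectivity of the logarithm need this positivity.\<close>
  have log_le: "log 2 (card I) \<le> log 2 D" using le H(5) by simp
  have log_eq: "log 2 (card I) = log 2 D \<longleftrightarrow> card I = D"
    using le H(5) by (simp add: log_def)
  have zero: "entropy Lam = 0 \<longleftrightarrow> unitarily_correctable N (kraus_map N m Es) P"
  proof
    assume "entropy Lam = 0"
    then have d01: "\<forall>i<m. d i = 0 \<or> d i = 1" using H(3) by simp
    \<comment> \<open>The entries are 0 or 1 with sum 1, so exactly one of them is 1.\<close>
    then have "(\<Sum>i<m. d i) = (\<Sum>i\<in>I. 1)"
      by (intro sum.mono_neutral_cong_right) (auto simp: I_def)
    then have "card I = 1" using d1 by simp
    then obtain k where k: "I = {k}" by (rule card_1_singletonE)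
    then have km: "k < m" "d k = 1" using d01 by (auto simp: I_def)
    have dk: "d i = (if i = k then 1 else 0)" if "i < m" for i
      using k km that by (auto simp: I_def)
    \<comment> \<open>Only the term at \<open>k\<close> of the spectral decomposition survives. The
      vector u is the conjugate of column \<open>k\<close> of \<open>U\<close>, because the rank-one
      form wanted here conjugates its first factor.\<close>
    have "lam i j = cnj (cnj (U $$ (i,k))) * cnj (U $$ (j,k))" if ij: "i < m" "j < m" for i j
    proof -
      have UD: "U * mat_diag m (\<lambda>i. complex_of_real (d i))
          = mat m m (\<lambda>(i,l). U $$ (i,l) * complex_of_real (d l))"
        by (rule mat_diag_mult_right[OF Uc])
      have "lam i j = Lam $$ (i,j)" using ij by (simp add: Lam_def)
      also have "\<dots> = (\<Sum>l<m. U $$ (i,l) * complex_of_real (d l) * cnj (U $$ (j,l)))"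
        unfolding LU UD using ij Uc
        by (subst mult_mat_index_sum[of _ m m _ m]) (auto intro!: sum.cong)
      also have "\<dots> = (\<Sum>l<m. if l = k then U $$ (i,k) * cnj (U $$ (j,k)) else 0)"
        by (intro sum.cong) (auto simp: dk)
      also have "\<dots> = U $$ (i,k) * cnj (U $$ (j,k))" using km by simp
      finally show ?thesis by simp
    qed
    then show "unitarily_correctable N (kraus_map N m Es) P"
      by (rule unitarily_correctable_if_rank_one[of "\<lambda>i. cnj (U $$ (i,k))"])
  next
    assume "unitarily_correctable N (kraus_map N m Es) P"
    note idem = Lam_square_idempotent_if_unitarily_correctable[OF this]
    note sq = diag_of_unitary_form(3)[OF U LU]
    \<comment> \<open>The square of \<open>Lam\<close> and its fourth power are diagonal under the
      same \<open>U\<close>, so idempotence of the square says that each \<open>d i\<close> has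
      equal second and fourth powers; as \<open>d i\<close> is nonnegative, it is 0 or 1.\<close>
    have diag_eq: "mat_diag m (\<lambda>i. complex_of_real (d i) * complex_of_real (d i) * (complex_of_real (d i) * complex_of_real (d i)))
        = mat_diag m (\<lambda>i. complex_of_real (d i) * complex_of_real (d i))"
      using diag_of_unitary_form(1)[OF U sq]
        diag_of_unitary_form(1)[OF U diag_of_unitary_form(3)[OF U sq]] idem by simp
    have eq: "complex_of_real (d i) * of_real (d i) * (of_real (d i) * of_real (d i)) = of_real (d i) * of_real (d i)"
      if "i < m" for i
      using arg_cong[OF diag_eq, of "\<lambda>M. M $$ (i,i)"] that by (simp add: mat_diag_def)
    have "d i = 0 \<or> d i = 1" if i: "i < m" for i
    proof -
      have "d i * d i * (d i * d i) = d i * d i" using eq[OF i] by (simp only: of_real_mult[symmetric] of_real_eq_iff)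
      then have "d i = 0 \<or> (d i)\<^sup>2 = 1" by (simp add: power2_eq_square)
      then show ?thesis using d0 i by (auto simp: power2_eq_1_iff)
    qed
    then show "entropy Lam = 0" using H(3) by simp
  qed
  have "entropy Lam = log 2 D \<longleftrightarrow> card I = D \<and> entropy Lam = log 2 (card I)"
    using H(2) log_le log_eq by auto
  also have "\<dots> \<longleftrightarrow> nondegenerate_code m Lam D"
  proof -
    have "(\<forall>i\<in>I. \<forall>j\<in>I. d i = d j) \<longleftrightarrow>
        (\<forall>a b. eigenvalue Lam a \<and> eigenvalue Lam b \<and> a \<noteq> 0 \<and> b \<noteq> 0 \<longrightarrow> a = b)"
      (is "?L \<longleftrightarrow> ?R")
    proof
      assume L: ?L
      show ?R
      proof (intro allI impI)
        fix a b assume ab: "eigenvalue Lam a \<and> eigenvalue Lam b \<and> a \<noteq> 0 \<and> b \<noteq> 0"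
        then obtain i j where "i < m" "a = complex_of_real (d i)" "j < m" "b = complex_of_real (d j)"
          using ev by blast
        moreover from this ab have "i \<in> I" "j \<in> I" by (auto simp: I_def)
        ultimately show "a = b" using L[rule_format, of i j] by simp
      qed
    next
      assume R: ?R
      show ?L
      proof (intro ballI)
        fix i j assume "i \<in> I" "j \<in> I"
        then have "complex_of_real (d i) = complex_of_real (d j)"
          using R[rule_format, of "of_real (d i)" "of_real (d j)"] ev by (auto simp: I_def)
        then show "d i = d j" by (simp only: of_real_eq_iff)
      qed
    qed
    from trans[OF H(4) this] show ?thesis unfolding nondegenerate_code_def rank by simp
  qed
  finally show ?thesis using H(1,2) log_le zero by auto
qed

end

theorem theorem2p3:
  fixes N m :: nat and Es :: "nat \<Rightarrow> complex mat" and P :: "complex mat"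
    and lam :: "nat \<Rightarrow> nat \<Rightarrow> complex"
  defines "\<Phi> \<equiv> kraus_map N m Es"
    and "\<Lambda> \<equiv> mat m m (\<lambda>(i,j). lam i j)"
    and "D \<equiv> choi_rank N (kraus_map N m Es)"
  assumes kraus: "kraus_family N m Es"
    and proj: "orth_projection N P" and nonzero: "P \<noteq> 0\<^sub>m N N"
    and code: "\<forall>i<m. \<forall>j<m. P * mat_adjoint (Es i) * Es j * P = lam i j \<cdot>\<^sub>m P"
  shows "(0 \<le> entropy \<Lambda> \<and> entropy \<Lambda> \<le> log 2 (real D)) \<and>
         (entropy \<Lambda> = 0 \<longleftrightarrow> unitarily_correctable N \<Phi> P) \<and>
         (entropy \<Lambda> = log 2 (real D) \<longleftrightarrow> nondegenerate_code m \<Lambda> D)"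
proof -
  interpret qec_code N m Es P lam
    by (rule qec_code.intro[OF kraus proj nonzero code])
  show ?thesis
    using entropy_characterization unfolding Lam_def \<Phi>_def \<Lambda>_def D_def .
qed

end
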